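(* Suppose that $X$ is a compactly generated Hausdorff path connected space. Then $X$ is a Gottlieb space if and only if $X$ is a Gottlieb-Fox space.
   Context: Fix a basepoint $x_0\in X$. Let $X^X$ be the space of maps $X\to X$, with basepoint $1_X$, and let $ev:X^X\to X$ be evaluation at $x_0$. For $n\ge 1$, the $n$-th Gottlieb group is $G_n(X)=\mathrm{Im}(ev_*:\pi_n(X^X,1_X)\to\pi_n(X,x_0))$. The space $X$ is a Gottlieb space if $G_n(X)=\pi_n(X,x_0)$ for all $n\ge 1$. The $n$-th Fox torus homotopy group of a space $Z$ with basepoint $z_0$ is $\tau_n(Z,z_0)=\pi_1(Z^{T^{n-1}},c_{z_0})$, where $T^{n-1}$ is the $(n-1)$-dimensional torus ($T^0$ is a point), $Z^{T^{n-1}}$ is the space of maps $T^{n-1}\to Z$ and $c_{z_0}$ is the constant map at $z_0$. The $n$-th Gottlieb-Fox group is $G\tau_n(X)=\mathrm{Im}(ev_*:\tau_n(X^X,1_X)\to\tau_n(X,x_0))$. The space $X$ is a Gottlieb-Fox space if $G\tau_n(X)=\tau_n(X,x_0)$ for all $n\ge 1$. *)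

theory Defs
  imports "HOL-Analysis.Analysis" "HOL-Algebra.Group"
begin

text \<open>The space of continuous maps from \<open>X\<close> to \<open>Y\<close> with the compact-open topology. Its points are
  extensional on the topological space of \<open>X\<close>, so each continuous map is represented exactly once.
  The sets with \<open>K = {}\<close> make the whole function set belong to the subbasis.\<close>

definition mapping_space :: "'a topology \<Rightarrow> 'b topology \<Rightarrow> ('a \<Rightarrow> 'b) topology" where
  "mapping_space X Y = topology_generated_by
     {{f \<in> extensional (topspace X). continuous_map X Y f \<and> f ` K \<subseteq> U} | K U.
        compactin X K \<and> openin Y U}"

definition cube :: "nat \<Rightarrow> (nat \<Rightarrow> real) topology" where
  "cube n = product_topology (\<lambda>_. top_of_set {0..1}) {..<n}"

definition cube_boundary :: "nat \<Rightarrow> (nat \<Rightarrow> real) set" where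
  "cube_boundary n = {x \<in> topspace (cube n). \<exists>i<n. x i = 0 \<or> x i = 1}"

definition spheroids :: "nat \<Rightarrow> 'a topology \<Rightarrow> 'a \<Rightarrow> ((nat \<Rightarrow> real) \<Rightarrow> 'a) set" where
  "spheroids n Z z = {f. continuous_map (cube n) Z f \<and> (\<forall>x\<in>cube_boundary n. f x = z)}"

definition spheroid_homotopy ::
    "nat \<Rightarrow> 'a topology \<Rightarrow> 'a \<Rightarrow> (((nat \<Rightarrow> real) \<Rightarrow> 'a) \<times> ((nat \<Rightarrow> real) \<Rightarrow> 'a)) set" where
  "spheroid_homotopy n Z z =
     {(f, g). homotopic_with (\<lambda>h. \<forall>x\<in>cube_boundary n. h x = z) (cube n) Z f g}"

definition spheroid_concat ::
    "((nat \<Rightarrow> real) \<Rightarrow> 'a) \<Rightarrow> ((nat \<Rightarrow> real) \<Rightarrow> 'a) \<Rightarrow> (nat \<Rightarrow> real) \<Rightarrow> 'a" where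
  "spheroid_concat f g x =
     (if x 0 \<le> 1/2 then f (x(0 := 2 * x 0)) else g (x(0 := 2 * x 0 - 1)))"

text \<open>The homotopy group \<open>\<pi>\<^sub>n(Z, z)\<close>, meaningful for \<open>n \<ge> 1\<close> and \<open>z \<in> topspace Z\<close>. Elements are
  homotopy classes of maps from the \<open>n\<close>-cube to \<open>Z\<close> relative to the boundary; values of
  representatives outside the cube are irrelevant, since functions agreeing on the cube are
  homotopic.\<close>

definition homotopy_group ::
    "nat \<Rightarrow> 'a topology \<Rightarrow> 'a \<Rightarrow> ((nat \<Rightarrow> real) \<Rightarrow> 'a) set monoid" where
  "homotopy_group n Z z =
     \<lparr>carrier = spheroids n Z z // spheroid_homotopy n Z z,
      mult = (\<lambda>A B. spheroid_homotopy n Z z `` {spheroid_concat f g | f g. f \<in> A \<and> g \<in> B}),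
      one = spheroid_homotopy n Z z `` {\<lambda>_. z}\<rparr>"

text \<open>The map on \<open>\<pi>\<^sub>n\<close> induced by a continuous map \<open>\<phi>\<close> into \<open>Y\<close> sending the basepoint to \<open>y\<close>:
  the class of \<open>g\<close> is sent to the class of \<open>\<phi> \<circ> g\<close>.\<close>

definition homotopy_group_map ::
    "nat \<Rightarrow> 'b topology \<Rightarrow> 'b \<Rightarrow> ('a \<Rightarrow> 'b) \<Rightarrow>
     ((nat \<Rightarrow> real) \<Rightarrow> 'a) set \<Rightarrow> ((nat \<Rightarrow> real) \<Rightarrow> 'b) set" where
  "homotopy_group_map n Y y \<phi> A = spheroid_homotopy n Y y `` ((\<lambda>g. \<phi> \<circ> g) ` A)"

definition torus :: "nat \<Rightarrow> (nat \<Rightarrow> complex) topology" where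
  "torus k = product_topology (\<lambda>_. top_of_set (sphere 0 1)) {..<k}"

definition fox_group ::
    "nat \<Rightarrow> 'a topology \<Rightarrow> 'a \<Rightarrow> ((nat \<Rightarrow> real) \<Rightarrow> (nat \<Rightarrow> complex) \<Rightarrow> 'a) set monoid" where
  "fox_group n Z z =
     homotopy_group 1 (mapping_space (torus (n - 1)) Z) (\<lambda>t\<in>topspace (torus (n - 1)). z)"

definition fox_group_map ::
    "nat \<Rightarrow> 'b topology \<Rightarrow> 'b \<Rightarrow> ('a \<Rightarrow> 'b) \<Rightarrow>
     ((nat \<Rightarrow> real) \<Rightarrow> (nat \<Rightarrow> complex) \<Rightarrow> 'a) set \<Rightarrow> ((nat \<Rightarrow> real) \<Rightarrow> (nat \<Rightarrow> complex) \<Rightarrow> 'b) set" where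
  "fox_group_map n Y y \<phi> =
     homotopy_group_map 1 (mapping_space (torus (n - 1)) Y) (\<lambda>t\<in>topspace (torus (n - 1)). y)
       (\<lambda>u. \<lambda>t\<in>topspace (torus (n - 1)). \<phi> (u t))"

definition gottlieb_group :: "nat \<Rightarrow> 'a topology \<Rightarrow> 'a \<Rightarrow> ((nat \<Rightarrow> real) \<Rightarrow> 'a) set set" where
  "gottlieb_group n X x\<^sub>0 =
     homotopy_group_map n X x\<^sub>0 (\<lambda>u. u x\<^sub>0) `
       carrier (homotopy_group n (mapping_space X X) (\<lambda>x\<in>topspace X. x))"

definition gottlieb_fox_group ::
    "nat \<Rightarrow> 'a topology \<Rightarrow> 'a \<Rightarrow> ((nat \<Rightarrow> real) \<Rightarrow> (nat \<Rightarrow> complex) \<Rightarrow> 'a) set set" where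
  "gottlieb_fox_group n X x\<^sub>0 =
     fox_group_map n X x\<^sub>0 (\<lambda>u. u x\<^sub>0) `
       carrier (fox_group n (mapping_space X X) (\<lambda>x\<in>topspace X. x))"

definition gottlieb_space :: "'a topology \<Rightarrow> 'a \<Rightarrow> bool" where
  "gottlieb_space X x\<^sub>0 \<longleftrightarrow>
     (\<forall>n\<ge>1. gottlieb_group n X x\<^sub>0 = carrier (homotopy_group n X x\<^sub>0))"

definition gottlieb_fox_space :: "'a topology \<Rightarrow> 'a \<Rightarrow> bool" where
  "gottlieb_fox_space X x\<^sub>0 \<longleftrightarrow>
     (\<forall>n\<ge>1. gottlieb_fox_group n X x\<^sub>0 = carrier (fox_group n X x\<^sub>0))"

end

theory Submission
  imports Defs
begin

text \<open>The theorem is an instance of a statement about an arbitrary continuous pointed map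
\<open>p : (Z, z) \<rightarrow> (Y, y)\<close>: it is surjective on all homotopy groups \<open>\<pi>\<^sub>n\<close> if and only if it is
surjective on all Fox groups \<open>\<tau>\<^sub>n\<close> (\<open>surjective_on_homotopy_iff_surjective_on_fox\<close>). The case of
interest is evaluation at \<open>x\<^sub>0\<close>, from the space of self-maps of \<open>X\<close> based at the identity to \<open>X\<close>.

By the exponential law for the compact Hausdorff torus, a based loop of maps from the
\<open>(n - 1)\<close>-torus to \<open>Y\<close> is the same as a map on the \<open>n\<close>-cube that is constant on the two ends of the
first coordinate and periodic in the others, here called a torus loop (\<open>fox_lifting_iff\<close>). A
spheroid is a torus loop that is constant on all faces. So two classes of maps on the same cube are
to be compared, and in both cases surjectivity of \<open>p\<close> means that each map into \<open>Y\<close> of the class is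
homotopic, within the class, to \<open>p \<circ> F\<close> for a map \<open>F\<close> into \<open>Z\<close> of the class.

The comparison rests on one construction. Given a torus loop \<open>f\<close> and a torus coordinate \<open>j\<close>, let
\<open>peel j f\<close> be \<open>f\<close> times the inverse of its restriction to the subtorus where coordinate \<open>j\<close> is
trivial, multiplication being composition of loops. On that subtorus it is a loop followed by its
inverse, and a collar is used to contract this product, so that \<open>peel j f\<close> is constant on the two
faces orthogonal to \<open>j\<close>. The formula involves \<open>f\<close> only through substitution in its argument.
Therefore it works for homotopies as well, and it commutes with composition by \<open>p\<close>.

If \<open>p\<close> is surjective on Fox groups, lift a spheroid as a torus loop and peel all coordinates of the
lift. The result is a spheroid, and it still lifts the given one, because peeling a map that is
constant on the faces in question does not change its class
(\<open>lifts_torus_loops_imp_lifts_spheroids\<close>).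

If \<open>p\<close> is surjective on homotopy groups, use that a torus loop \<open>f\<close> is homotopic to the product of
\<open>peel j f\<close> with a loop that does not depend on coordinate \<open>j\<close>. Repeating this for the other
coordinates decomposes \<open>f\<close> into factors in which each coordinate is either trivial on its faces or
ignored. Such a factor is a spheroid of possibly lower dimension, which has a lift. The product of
the lifts of the factors is a lift of \<open>f\<close> (\<open>lifts_spheroids_imp_lifts_torus_loops\<close>).\<close>

section \<open>Torus loops on the cube\<close>

lemma topspace_cube: "x \<in> topspace (cube n) \<longleftrightarrow> x \<in> extensional {..<n} \<and> (\<forall>i<n. 0 \<le> x i \<and> x i \<le> 1)"
  by (auto simp: cube_def PiE_iff)

lemma cube_update:
  assumes "x \<in> topspace (cube n)" "i < n" "0 \<le> r" "r \<le> 1"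
  shows "x(i := r) \<in> topspace (cube n)"
  using assms by (auto simp: topspace_cube extensional_def)

lemma continuous_map_cube_component:
  assumes "continuous_map A (cube n) g" "i < n"
  shows "continuous_map A euclideanreal (\<lambda>a. g a i)"
  using assms by (auto simp: cube_def continuous_map_componentwise continuous_map_in_subtopology)

lemma continuous_map_cube_update:
  assumes g: "continuous_map A (cube n) g" and "i < n"
    and r: "continuous_map A euclideanreal r" "\<And>a. a \<in> topspace A \<Longrightarrow> 0 \<le> r a \<and> r a \<le> 1"
  shows "continuous_map A (cube n) (\<lambda>a. (g a)(i := r a))"
proof -
  have "(g a)(i := r a) \<in> extensional {..<n}" if "a \<in> topspace A" for a
    using that g \<open>i < n\<close> by (auto simp: cube_def continuous_map_componentwise extensional_def)
  moreover have "continuous_map A (top_of_set {0..1::real}) (\<lambda>a. ((g a)(i := r a)) k)" if "k < n" for k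
    using that g r by (cases "k = i") (auto simp: cube_def continuous_map_componentwise continuous_map_in_subtopology)
  ultimately show ?thesis
    unfolding cube_def continuous_map_componentwise by auto
qed

text \<open>The predicate interpolates between the representatives of two kinds of homotopy classes. A map on
the cube that is constant on the ends of coordinate \<open>0\<close> and periodic in each other coordinate is a
based loop of maps from a torus, whence the representatives of the Fox group for \<open>S = {}\<close>; for
\<open>S = {1..<n}\<close> the whole boundary goes to \<open>y\<close>, and the map is a spheroid. Intermediate sets \<open>S\<close>
allow the passage from one extreme to the other one coordinate at a time.\<close>

definition torus_loop :: "nat \<Rightarrow> 'a \<Rightarrow> nat set \<Rightarrow> ((nat \<Rightarrow> real) \<Rightarrow> 'a) \<Rightarrow> bool" where
  "torus_loop n y S h \<longleftrightarrow>
     (\<forall>x\<in>topspace (cube n).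
        (x 0 = 0 \<or> x 0 = 1 \<longrightarrow> h x = y) \<and>
        (\<forall>j\<in>{1..<n}. h (x(j := 0)) = h (x(j := 1))) \<and>
        (\<forall>j\<in>S. x j = 0 \<or> x j = 1 \<longrightarrow> h x = y))"

abbreviation torus_homotopic ::
    "nat \<Rightarrow> 'a topology \<Rightarrow> 'a \<Rightarrow> nat set \<Rightarrow> ((nat \<Rightarrow> real) \<Rightarrow> 'a) \<Rightarrow> ((nat \<Rightarrow> real) \<Rightarrow> 'a) \<Rightarrow> bool" where
  "torus_homotopic n Y y S \<equiv> homotopic_with (torus_loop n y S) (cube n) Y"

lemma torus_loopI:
  assumes "\<And>x. x \<in> topspace (cube n) \<Longrightarrow> x 0 = 0 \<or> x 0 = 1 \<Longrightarrow> h x = y"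
    and "\<And>x j. x \<in> topspace (cube n) \<Longrightarrow> 1 \<le> j \<Longrightarrow> j < n \<Longrightarrow> h (x(j := 0)) = h (x(j := 1))"
    and "\<And>x j. x \<in> topspace (cube n) \<Longrightarrow> j \<in> S \<Longrightarrow> x j = 0 \<or> x j = 1 \<Longrightarrow> h x = y"
  shows "torus_loop n y S h"
  using assms unfolding torus_loop_def by auto

lemma torus_loop_end:
  "torus_loop n y S h \<Longrightarrow> x \<in> topspace (cube n) \<Longrightarrow> x 0 = 0 \<or> x 0 = 1 \<Longrightarrow> h x = y"
  unfolding torus_loop_def by blast

lemma torus_loop_face:
  "torus_loop n y S h \<Longrightarrow> x \<in> topspace (cube n) \<Longrightarrow> j \<in> S \<Longrightarrow> x j = 0 \<or> x j = 1 \<Longrightarrow> h x = y"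
  unfolding torus_loop_def by blast

lemma torus_loop_periodic:
  "torus_loop n y S h \<Longrightarrow> x \<in> topspace (cube n) \<Longrightarrow> 1 \<le> j \<Longrightarrow> j < n \<Longrightarrow> h (x(j := 0)) = h (x(j := 1))"
  unfolding torus_loop_def by auto

lemma torus_loop_mono: "torus_loop n y S h \<Longrightarrow> S' \<subseteq> S \<Longrightarrow> torus_loop n y S' h"
  unfolding torus_loop_def by blast

lemma torus_loop_cong:
  assumes "\<And>x. x \<in> topspace (cube n) \<Longrightarrow> h x = k x"
  shows "torus_loop n y S h \<longleftrightarrow> torus_loop n y S k"
proof -
  have "h (x(j := 0)) = k (x(j := 0))" "h (x(j := 1)) = k (x(j := 1))"
    if "x \<in> topspace (cube n)" "j \<in> {1..<n}" for x j
    using that by (auto intro!: assms cube_update)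
  with assms show ?thesis
    unfolding torus_loop_def by (intro ball_cong conj_cong refl) simp_all
qed

lemma torus_homotopicI:
  assumes "continuous_map (prod_topology (top_of_set {0..1::real}) (cube n)) Y h"
    and "\<And>x. x \<in> topspace (cube n) \<Longrightarrow> h (0, x) = f x"
    and "\<And>x. x \<in> topspace (cube n) \<Longrightarrow> h (1, x) = g x"
    and "\<And>t. 0 \<le> t \<Longrightarrow> t \<le> 1 \<Longrightarrow> torus_loop n y S (\<lambda>x. h (t, x))"
  shows "torus_homotopic n Y y S f g"
proof -
  have "\<exists>h. continuous_map (prod_topology (top_of_set {0..1::real}) (cube n)) Y h \<and>
              (\<forall>x \<in> topspace (cube n). h (0, x) = f x) \<and>
              (\<forall>x \<in> topspace (cube n). h (1, x) = g x) \<and>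
              (\<forall>t \<in> {0..1}. torus_loop n y S (\<lambda>x. h (t, x)))"
    using assms by (intro exI[of _ h] conjI ballI) simp_all
  then show ?thesis
    by (rule iffD2[OF homotopic_with, rotated]) (rule torus_loop_cong)
qed

lemma torus_homotopicE:
  assumes "torus_homotopic n Y y S f g"
  obtains h where "continuous_map (prod_topology (top_of_set {0..1::real}) (cube n)) Y h"
    and "\<And>x. h (0, x) = f x" and "\<And>x. h (1, x) = g x"
    and "\<And>t. t \<in> {0..1} \<Longrightarrow> torus_loop n y S (\<lambda>x. h (t, x))"
  using assms unfolding homotopic_with_def by (elim exE conjE) simp

lemma torus_homotopic_equal:
  assumes "continuous_map (cube n) Y f" "torus_loop n y S f"
    and "\<And>x. x \<in> topspace (cube n) \<Longrightarrow> f x = g x"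
  shows "torus_homotopic n Y y S f g"
  using assms torus_loop_cong[OF assms(3)] by (intro homotopic_with_equal) simp_all

lemma torus_loop_compose:
  "torus_loop n z S f \<Longrightarrow> p z = y \<Longrightarrow> torus_loop n y S (p \<circ> f)"
  unfolding torus_loop_def by auto

section \<open>Concatenation\<close>

lemma continuous_map_constant_family:
  "continuous_map X Y f \<Longrightarrow> continuous_map (prod_topology W X) Y (\<lambda>(w, x). f x)"
  using continuous_map_compose[OF continuous_map_snd[of W X], of Y f] by (simp add: o_def case_prod_unfold)

lemma continuous_map_slice:
  assumes "continuous_map (prod_topology W X) Y h" "w \<in> topspace W"
  shows "continuous_map X Y (\<lambda>x. h (w, x))"
  using continuous_map_compose[of X "prod_topology W X" "\<lambda>x. (w, x)" Y h] assms
  by (simp add: o_def continuous_map_paired)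

lemma continuous_map_cube_substitution:
  assumes "continuous_map (prod_topology W (cube n)) Y f"
    and "continuous_map (prod_topology W (cube n)) (cube n) (\<lambda>a. r (fst a) (snd a))"
  shows "continuous_map (prod_topology W (cube n)) Y (\<lambda>(w, x). f (w, r w x))"
proof -
  have "continuous_map (prod_topology W (cube n)) (prod_topology W (cube n)) (\<lambda>a. (fst a, r (fst a) (snd a)))"
    using assms(2) by (intro continuous_intros)
  from continuous_map_compose[OF this assms(1)] show ?thesis
    by (simp add: o_def case_prod_unfold)
qed

text \<open>The auxiliary space \<open>W\<close> serves two purposes: with the unit interval it gives continuity of
homotopies built from concatenations, with any nonempty space and a family constant in \<open>w\<close> it gives
continuity of a single concatenation. Only agreement at the seam is required, because the halves of
the constructions below are paths and not loops.\<close>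

lemma continuous_map_spheroid_concat:
  assumes n: "0 < n"
    and f: "continuous_map (prod_topology W (cube n)) Z f"
    and g: "continuous_map (prod_topology W (cube n)) Z g"
    and match: "\<And>w x. w \<in> topspace W \<Longrightarrow> x \<in> topspace (cube n) \<Longrightarrow>
                  f (w, x(0 := 1)) = g (w, x(0 := 0))"
  shows "continuous_map (prod_topology W (cube n)) Z
           (\<lambda>(w, x). spheroid_concat (\<lambda>x. f (w, x)) (\<lambda>x. g (w, x)) x)"
proof -
  let ?P = "prod_topology W (cube n)"
  have x0: "continuous_map ?P euclideanreal (\<lambda>a. snd a 0)"
    using continuous_map_cube_component[OF continuous_map_snd] n by blast
  have pos: "0 \<le> snd a 0" "snd a 0 \<le> 1" if "a \<in> topspace ?P" for a
    using that n by (auto simp: topspace_cube)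
  have f': "continuous_map ?P Z (\<lambda>(w, x). f (w, x(0 := min 1 (2 * x 0))))"
    using n x0 pos
    by (intro continuous_map_cube_substitution f continuous_map_cube_update continuous_map_snd
          continuous_intros continuous_map_real_mult_left) auto
  have g': "continuous_map ?P Z (\<lambda>(w, x). g (w, x(0 := max 0 (2 * x 0 - 1))))"
    using n x0 pos
    by (intro continuous_map_cube_substitution g continuous_map_cube_update continuous_map_snd
          continuous_intros continuous_map_real_mult_left) auto
  \<comment> \<open>The clamped substitutions are defined on the whole cube, unlike those of
    \<open>spheroid_concat\<close>, and agree with them on the half where they are used.\<close>
  have "continuous_map ?P Z (\<lambda>a. if snd a 0 \<le> 1/2
      then (\<lambda>(w, x). f (w, x(0 := min 1 (2 * x 0)))) a
      else (\<lambda>(w, x). g (w, x(0 := max 0 (2 * x 0 - 1)))) a)"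
  proof (intro continuous_map_cases_le continuous_map_from_subtopology x0 f' g')
    fix a assume "a \<in> topspace ?P" and half: "snd a 0 = 1/2"
    then show "(\<lambda>(w, x). f (w, x(0 := min 1 (2 * x 0)))) a = (\<lambda>(w, x). g (w, x(0 := max 0 (2 * x 0 - 1)))) a"
      using match[of "fst a" "snd a"] by (auto simp: case_prod_unfold)
  qed auto
  then show ?thesis
    by (rule continuous_map_eq) (auto simp: spheroid_concat_def min_absorb2 max_absorb2)
qed

lemma torus_loop_spheroid_concatI:
  assumes n: "0 < n" and S: "0 \<notin> S"
    and start: "\<And>x. x \<in> topspace (cube n) \<Longrightarrow> x 0 = 0 \<Longrightarrow> f x = y"
    and finish: "\<And>x. x \<in> topspace (cube n) \<Longrightarrow> x 0 = 1 \<Longrightarrow> g x = y"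
    and f: "\<And>x j. x \<in> topspace (cube n) \<Longrightarrow> 1 \<le> j \<Longrightarrow> j < n \<Longrightarrow> f (x(j := 0)) = f (x(j := 1))"
    and g: "\<And>x j. x \<in> topspace (cube n) \<Longrightarrow> 1 \<le> j \<Longrightarrow> j < n \<Longrightarrow> g (x(j := 0)) = g (x(j := 1))"
    and fS: "\<And>x j. x \<in> topspace (cube n) \<Longrightarrow> j \<in> S \<Longrightarrow> x j = 0 \<or> x j = 1 \<Longrightarrow> f x = y"
    and gS: "\<And>x j. x \<in> topspace (cube n) \<Longrightarrow> j \<in> S \<Longrightarrow> x j = 0 \<or> x j = 1 \<Longrightarrow> g x = y"
  shows "torus_loop n y S (spheroid_concat f g)"
proof (rule torus_loopI)
  fix x assume x: "x \<in> topspace (cube n)"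
  then have b: "0 \<le> x 0" "x 0 \<le> 1" using n by (auto simp: topspace_cube)
  show "spheroid_concat f g x = y" if "x 0 = 0 \<or> x 0 = 1"
    using that start[OF x] finish[OF x] by (auto simp: spheroid_concat_def fun_upd_idem)
  have L: "x(0 := 2 * x 0) \<in> topspace (cube n)" if "x 0 \<le> 1/2"
    using that b n x by (auto intro!: cube_update)
  have R: "x(0 := 2 * x 0 - 1) \<in> topspace (cube n)" if "\<not> x 0 \<le> 1/2"
    using that b n x by (auto intro!: cube_update)
  show "spheroid_concat f g (x(j := 0)) = spheroid_concat f g (x(j := 1))" if "1 \<le> j" "j < n" for j
    using f[OF L that] g[OF R that] that
    by (auto simp: spheroid_concat_def fun_upd_twist)
  show "spheroid_concat f g x = y" if "j \<in> S" "x j = 0 \<or> x j = 1" for j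
  proof -
    have "j \<noteq> 0" using that S by metis
    then show ?thesis
      using fS[OF L that(1)] gS[OF R that(1)] that
      by (auto simp: spheroid_concat_def)
  qed
qed

lemma torus_loop_spheroid_concat:
  assumes "0 < n" "0 \<notin> S" and f: "torus_loop n y S f" and g: "torus_loop n y S g"
  shows "torus_loop n y S (spheroid_concat f g)"
  by (rule torus_loop_spheroid_concatI)
    (use assms in \<open>blast intro: torus_loop_end[OF f] torus_loop_end[OF g] torus_loop_periodic[OF f]
       torus_loop_periodic[OF g] torus_loop_face[OF f] torus_loop_face[OF g]\<close>)+

lemma torus_homotopic_spheroid_concat:
  assumes n: "0 < n" and S: "0 \<notin> S"
    and f: "torus_homotopic n Y y S f f'" and g: "torus_homotopic n Y y S g g'"
  shows "torus_homotopic n Y y S (spheroid_concat f g) (spheroid_concat f' g')"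
proof -
  obtain h where h: "continuous_map (prod_topology (top_of_set {0..1::real}) (cube n)) Y h"
    "\<And>x. h (0, x) = f x" "\<And>x. h (1, x) = f' x" "\<And>t. t \<in> {0..1} \<Longrightarrow> torus_loop n y S (\<lambda>x. h (t, x))"
    by (rule torus_homotopicE[OF f]) (rule that)
  obtain k where k: "continuous_map (prod_topology (top_of_set {0..1::real}) (cube n)) Y k"
    "\<And>x. k (0, x) = g x" "\<And>x. k (1, x) = g' x" "\<And>t. t \<in> {0..1} \<Longrightarrow> torus_loop n y S (\<lambda>x. k (t, x))"
    by (rule torus_homotopicE[OF g]) (rule that)
  show ?thesis
  proof (rule torus_homotopicI)
    show "continuous_map (prod_topology (top_of_set {0..1::real}) (cube n)) Y
            (\<lambda>(w, x). spheroid_concat (\<lambda>x. h (w, x)) (\<lambda>x. k (w, x)) x)"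
      using n torus_loop_end[OF h(4)] torus_loop_end[OF k(4)]
      by (intro continuous_map_spheroid_concat h(1) k(1)) (auto simp: cube_update)
  qed (use n S h k in \<open>auto intro!: torus_loop_spheroid_concat\<close>)
qed

section \<open>Making a loop of tori constant on a face\<close>

text \<open>The two profiles divide an edge of the cube into thirds. The outer thirds form a collar: there
\<open>collar_collapse\<close> is stuck at \<open>0\<close> or \<open>1\<close> while \<open>collar_height\<close> descends to \<open>0\<close> at the face. The
middle third is stretched by \<open>collar_collapse\<close> over the whole edge at full height. Truncation at
\<open>0\<close> keeps both values in the unit interval also for arguments outside it.\<close>

definition collar_height :: "real \<Rightarrow> real" where
  "collar_height r = max 0 (min 1 (min (3 * r) (3 - 3 * r)))"

definition collar_collapse :: "real \<Rightarrow> real" where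
  "collar_collapse r = max 0 (min 1 (3 * r - 1))"

lemma collar_bounds:
  "0 \<le> collar_height r" "collar_height r \<le> 1" "0 \<le> collar_collapse r" "collar_collapse r \<le> 1"
  by (auto simp: collar_height_def collar_collapse_def)

lemma collar_at_ends [simp]:
  "collar_height 0 = 0" "collar_height 1 = 0" "collar_collapse 0 = 0" "collar_collapse 1 = 1"
  by (auto simp: collar_height_def collar_collapse_def)

lemma collar_cases: "collar_height r = 1 \<or> collar_collapse r = 0 \<or> collar_collapse r = 1"
  by (auto simp: collar_height_def collar_collapse_def min_def max_def)

lemma continuous_map_collar:
  assumes "continuous_map A euclideanreal r"
  shows "continuous_map A euclideanreal (\<lambda>a. collar_height (r a))"
    and "continuous_map A euclideanreal (\<lambda>a. collar_collapse (r a))"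
  unfolding collar_height_def collar_collapse_def using assms
  by (intro continuous_intros continuous_map_real_mult_left; simp)+

text \<open>Write \<open>f\<^sub>r\<close> for the path in coordinate \<open>0\<close> at \<open>x j = r\<close>. In the middle third, \<open>peel j f\<close> runs along
\<open>f\<^sub>r\<close> and returns along \<open>f\<^sub>0\<close>. At the border of that third, periodicity makes the two paths equal,
so the result is a path followed by its own inverse. The collar contracts it by going only up to
\<open>collar_height\<close> before turning back. Hence \<open>peel j f\<close> represents \<open>f\<close> times the inverse of its
restriction to the face \<open>x j = 0\<close>, and is constant on the two faces orthogonal to \<open>j\<close> as an actual
map and not merely up to homotopy. This explicit contraction takes the place of an appeal to the
homotopy extension property.\<close>

definition peel :: "nat \<Rightarrow> ((nat \<Rightarrow> real) \<Rightarrow> 'a) \<Rightarrow> (nat \<Rightarrow> real) \<Rightarrow> 'a" where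
  "peel j f = spheroid_concat
     (\<lambda>x. f (x(0 := min (x 0) (collar_height (x j)), j := collar_collapse (x j))))
     (\<lambda>x. f (x(0 := min (1 - x 0) (collar_height (x j)), j := 0)))"

text \<open>This is why the outgoing and the returning path of \<open>peel\<close> meet at their turning point: either the
full height is reached, where both are at the base point, or \<open>collar_collapse\<close> is on a face and
periodicity applies. The level \<open>l\<close> may exceed the collar height, which is needed when the
contraction is undone by a homotopy.\<close>

lemma torus_loop_collar:
  assumes f: "torus_loop n y S f" and x: "x \<in> topspace (cube n)" and j: "1 \<le> j" "j < n"
    and l: "collar_height (x j) \<le> l" "l \<le> 1"
  shows "f (x(0 := l, j := collar_collapse (x j))) = f (x(0 := l, j := 0))"
proof -
  have l0: "0 \<le> l" using l(1) collar_bounds(1)[of "x j"] by linarith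
  have X: "x(0 := l) \<in> topspace (cube n)"
    using l l0 x j by (intro cube_update) auto
  have E: "f (x(0 := l, j := r)) = y" if "l = 1" "0 \<le> r" "r \<le> 1" for r
    using that j by (intro torus_loop_end[OF f] cube_update X) auto
  consider "l = 1" | "collar_collapse (x j) = 0" | "collar_collapse (x j) = 1"
    using collar_cases[of "x j"] l by fastforce
  then show ?thesis
  proof cases
    case 1
    show ?thesis using E[OF 1] collar_bounds by simp
  qed (use torus_loop_periodic[OF f X j] in auto)
qed

lemma continuous_map_peel:
  assumes j: "1 \<le> j" "j < n"
    and f: "continuous_map (prod_topology W (cube n)) Z f"
    and loop: "\<And>w. w \<in> topspace W \<Longrightarrow> torus_loop n z S (\<lambda>x. f (w, x))"
  shows "continuous_map (prod_topology W (cube n)) Z (\<lambda>(w, x). peel j (\<lambda>x. f (w, x)) x)"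
proof -
  let ?P = "prod_topology W (cube n)"
  have n: "0 < n" using j by simp
  have c: "continuous_map ?P euclideanreal (\<lambda>a. snd a i)" if "i < n" for i
    using continuous_map_cube_component[OF continuous_map_snd that] .
  have pos: "0 \<le> snd a i" "snd a i \<le> 1" if "a \<in> topspace ?P" "i < n" for a i
    using that by (auto simp: topspace_cube)
  have A: "continuous_map ?P Z (\<lambda>(w, x). f (w, x(0 := min (x 0) (collar_height (x j)), j := collar_collapse (x j))))"
    using c pos n j
    by (intro continuous_map_cube_substitution f continuous_map_cube_update continuous_map_snd
          continuous_intros continuous_map_collar) (auto simp: collar_bounds min_le_iff_disj)
  have B: "continuous_map ?P Z (\<lambda>(w, x). f (w, x(0 := min (1 - x 0) (collar_height (x j)), j := 0)))"
    using c pos n j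
    by (intro continuous_map_cube_substitution f continuous_map_cube_update continuous_map_snd
          continuous_intros continuous_map_collar) (auto simp: collar_bounds min_le_iff_disj)
  show ?thesis
    using continuous_map_spheroid_concat[OF n A B] torus_loop_collar[OF loop] j
    by (auto simp: peel_def collar_bounds min_absorb2)
qed

lemma torus_homotopic_eq:
  assumes "torus_homotopic n Y y S f g"
    and "\<And>x. x \<in> topspace (cube n) \<Longrightarrow> f x = f' x"
    and "\<And>x. x \<in> topspace (cube n) \<Longrightarrow> g x = g' x"
  shows "torus_homotopic n Y y S f' g'"
  by (rule homotopic_with_eq[OF assms(1)]) (use assms(2,3) in simp, use assms(2,3) in simp, rule torus_loop_cong)

lemma torus_loop_peel:
  assumes j: "1 \<le> j" "j < n" and S: "0 \<notin> S" and f: "torus_loop n y S f"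
  shows "torus_loop n y (insert j S) (peel j f)"
proof -
  let ?A = "\<lambda>x. x(0 := min (x 0) (collar_height (x j)), j := collar_collapse (x j))"
  let ?B = "\<lambda>x. x(0 := min (1 - x 0) (collar_height (x j)), j := 0)"
  have n: "0 < n" using j by simp
  have j0: "j \<noteq> 0" using j by simp
  have A: "?A x \<in> topspace (cube n)" and B: "?B x \<in> topspace (cube n)"
    if x: "x \<in> topspace (cube n)" for x
  proof -
    have "0 \<le> x 0" "x 0 \<le> 1" using x n by (auto simp: topspace_cube)
    then show "?A x \<in> topspace (cube n)" "?B x \<in> topspace (cube n)"
      using x n j collar_bounds[of "x j"] by (auto intro!: cube_update simp: min_le_iff_disj)
  qed
  \<comment> \<open>On the faces orthogonal to \<open>j\<close> the collar has height \<open>0\<close>, so the path never leaves its start.\<close>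
  have low: "f (?A x) = y" "f (?B x) = y" if x: "x \<in> topspace (cube n)" and "x j = 0 \<or> x j = 1" for x
  proof -
    have "0 \<le> x 0" "x 0 \<le> 1" using x n by (auto simp: topspace_cube)
    then show "f (?A x) = y" "f (?B x) = y"
      using that(2) j0 by (auto intro!: torus_loop_end[OF f A[OF x]] torus_loop_end[OF f B[OF x]])
  qed
  have "torus_loop n y (insert j S) (spheroid_concat (\<lambda>x. f (?A x)) (\<lambda>x. f (?B x)))"
  proof (rule torus_loop_spheroid_concatI[OF n])
    show "0 \<notin> insert j S" using j S by auto
    fix x assume x: "x \<in> topspace (cube n)"
    show "f (?A x) = y" if "x 0 = 0"
      using that j by (intro torus_loop_end[OF f A[OF x]]) (auto simp: collar_bounds min_absorb1)
    show "f (?B x) = y" if "x 0 = 1"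
      using that j by (intro torus_loop_end[OF f B[OF x]]) (auto simp: collar_bounds min_absorb1)
    show "f (?A x) = y" if "i \<in> insert j S" "x i = 0 \<or> x i = 1" for i
    proof (cases "i = j")
      case False
      then have "i \<in> S" using that by simp
      moreover from this have "i \<noteq> 0" using S by metis
      ultimately show ?thesis using False that by (intro torus_loop_face[OF f A[OF x], of i]) auto
    qed (use low x that in auto)
    show "f (?B x) = y" if "i \<in> insert j S" "x i = 0 \<or> x i = 1" for i
    proof (cases "i = j")
      case False
      then have "i \<in> S" using that by simp
      moreover from this have "i \<noteq> 0" using S by metis
      ultimately show ?thesis using False that by (intro torus_loop_face[OF f B[OF x], of i]) auto
    qed (use low x that in auto)
    fix i assume i: "1 \<le> i" "i < n"
    have X: "x(i := 0) \<in> topspace (cube n)" "x(i := 1) \<in> topspace (cube n)"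
      using x i by (auto intro: cube_update)
    show "f (?A (x(i := 0))) = f (?A (x(i := 1)))"
    proof (cases "i = j")
      case True
      then have "f (?A (x(i := 0))) = y" "f (?A (x(i := 1))) = y" using low X by force+
      then show ?thesis by simp
    next
      case False
      then show ?thesis using torus_loop_periodic[OF f A[OF x] i] i by (simp add: fun_upd_twist)
    qed
    show "f (?B (x(i := 0))) = f (?B (x(i := 1)))"
    proof (cases "i = j")
      case True
      then have "f (?B (x(i := 0))) = y" "f (?B (x(i := 1))) = y" using low X by force+
      then show ?thesis by simp
    next
      case False
      then show ?thesis using torus_loop_periodic[OF f B[OF x] i] i by (simp add: fun_upd_twist)
    qed
  qed
  then show ?thesis by (simp add: peel_def)
qed

lemma continuous_map_peel_single:
  assumes "1 \<le> j" "j < n" "continuous_map (cube n) Z f" "torus_loop n z S f"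
  shows "continuous_map (cube n) Z (peel j f)"
proof -
  \<comment> \<open>A single map is a family constant in a parameter; any nonempty parameter space will do.\<close>
  have "continuous_map (prod_topology (discrete_topology UNIV) (cube n)) Z
          (\<lambda>(w::nat, x). peel j (\<lambda>x. (\<lambda>(w, x). f x) (w, x)) x)"
    by (rule continuous_map_peel[OF assms(1,2) continuous_map_constant_family[OF assms(3)]])
      (use assms(4) in simp)
  from continuous_map_slice[OF this, of 0] show ?thesis by simp
qed

lemma torus_homotopic_peel:
  assumes j: "1 \<le> j" "j < n" and S: "0 \<notin> S" and fg: "torus_homotopic n Y y S f g"
  shows "torus_homotopic n Y y (insert j S) (peel j f) (peel j g)"
proof -
  obtain h where h: "continuous_map (prod_topology (top_of_set {0..1::real}) (cube n)) Y h"
    "\<And>x. h (0, x) = f x" "\<And>x. h (1, x) = g x" "\<And>t. t \<in> {0..1} \<Longrightarrow> torus_loop n y S (\<lambda>x. h (t, x))"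
    by (rule torus_homotopicE[OF fg]) (rule that)
  show ?thesis
  proof (rule torus_homotopicI)
    show "continuous_map (prod_topology (top_of_set {0..1}) (cube n)) Y (\<lambda>(t, x). peel j (\<lambda>x. h (t, x)) x)"
      by (rule continuous_map_peel[OF j h(1)]) (use h(4) in simp)
    show "torus_loop n y (insert j S) (\<lambda>x. (\<lambda>(t, x). peel j (\<lambda>x. h (t, x)) x) (t, x))"
      if "0 \<le> t" "t \<le> 1" for t
      using torus_loop_peel[OF j S h(4)] that by simp
  qed (simp_all add: h)
qed

lemma convex_combination_unit:
  fixes a b t :: real
  assumes "0 \<le> t" "t \<le> 1" "0 \<le> a" "a \<le> 1" "0 \<le> b" "b \<le> 1"
  shows "0 \<le> (1 - t) * a + t * b" "(1 - t) * a + t * b \<le> 1"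
proof -
  show "0 \<le> (1 - t) * a + t * b" using assms by simp
  show "(1 - t) * a + t * b \<le> 1" using assms by (intro convex_bound_le) auto
qed

text \<open>The substitution moves no point off a face: it sends each end of coordinate \<open>0\<close> and each of the
two faces orthogonal to \<open>j\<close> into itself. The same is true of every map on the straight line to the
identity, so all conditions of \<open>torus_loop\<close> survive along it.\<close>

lemma torus_homotopic_reparam:
  assumes j: "1 \<le> j" "j < n" and S: "0 \<notin> S" and k: "1 \<le> k"
    and f: "continuous_map (cube n) Y f" "torus_loop n y S f"
  shows "torus_homotopic n Y y S (\<lambda>x. f (x(0 := min 1 (k * x 0), j := collar_collapse (x j)))) f"
proof -
  let ?r = "\<lambda>t x. x(0 := (1 - t) * min 1 (k * x 0) + t * x 0,
                    j := (1 - t) * collar_collapse (x j) + t * x j)"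
  let ?P = "prod_topology (top_of_set {0..1::real}) (cube n)"
  have n: "0 < n" using j by simp
  have j0: "j \<noteq> 0" using j by simp
  have b: "0 \<le> (1 - t) * min 1 (k * x 0) + t * x 0" "(1 - t) * min 1 (k * x 0) + t * x 0 \<le> 1"
      "0 \<le> (1 - t) * collar_collapse (x j) + t * x j" "(1 - t) * collar_collapse (x j) + t * x j \<le> 1"
    if "x \<in> topspace (cube n)" "0 \<le> t" "t \<le> 1" for t x
    using that n j k collar_bounds[of "x j"]
    by (auto intro!: convex_combination_unit simp: topspace_cube)
  have r: "?r t x \<in> topspace (cube n)" if "x \<in> topspace (cube n)" "0 \<le> t" "t \<le> 1" for t x
    using b[OF that] that n j by (intro cube_update) auto
  have c: "continuous_map ?P euclideanreal (\<lambda>a. snd a i)" if "i < n" for i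
    using continuous_map_cube_component[OF continuous_map_snd that] .
  have t: "continuous_map ?P euclideanreal fst"
    using continuous_map_into_fulltopology continuous_map_fst by blast
  show ?thesis
  proof (rule torus_homotopicI)
    show "continuous_map ?P Y (\<lambda>(t, x). (\<lambda>(t, x). f x) (t, ?r t x))"
      using n j b
      by (intro continuous_map_cube_substitution continuous_map_constant_family f continuous_map_cube_update
            continuous_map_snd continuous_intros continuous_map_real_mult_left continuous_map_collar c t) auto
    fix t :: real assume t: "0 \<le> t" "t \<le> 1"
    have "torus_loop n y S (\<lambda>x. f (?r t x))"
    proof (rule torus_loopI)
      fix x assume x: "x \<in> topspace (cube n)"
      show "f (?r t x) = y" if "x 0 = 0 \<or> x 0 = 1"
        using that j k by (intro torus_loop_end[OF f(2) r[OF x t]]) auto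
      show "f (?r t (x(i := 0))) = f (?r t (x(i := 1)))" if i: "1 \<le> i" "i < n" for i
        using torus_loop_periodic[OF f(2) r[OF x t] i] i j by (cases "i = j") (simp_all add: fun_upd_twist)
      show "f (?r t x) = y" if "i \<in> S" "x i = 0 \<or> x i = 1" for i
      proof -
        have "i \<noteq> 0" using that S by metis
        then show ?thesis using that by (intro torus_loop_face[OF f(2) r[OF x t], of i]) auto
      qed
    qed
    then show "torus_loop n y S (\<lambda>x. (\<lambda>(t, x). (\<lambda>(t, x). f x) (t, ?r t x)) (t, x))" by simp
  qed auto
qed

text \<open>If \<open>f\<close> is already constant on the faces orthogonal to \<open>j\<close>, then the return path and the collar
are constant, and \<open>peel\<close> only reparametrises \<open>f\<close>.\<close>

lemma torus_homotopic_peel_trivial_face: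
  assumes j: "1 \<le> j" "j < n" "j \<in> S" and S: "0 \<notin> S"
    and f: "continuous_map (cube n) Y f" "torus_loop n y S f"
  shows "torus_homotopic n Y y S (peel j f) f"
proof (rule homotopic_with_trans[OF torus_homotopic_equal])
  have n: "0 < n" using j by simp
  show "continuous_map (cube n) Y (peel j f)"
    using continuous_map_peel_single[OF j(1,2) f] .
  show "torus_loop n y S (peel j f)"
    using torus_loop_peel[OF j(1,2) S f(2)] j by (simp add: insert_absorb)
  show "torus_homotopic n Y y S (\<lambda>x. f (x(0 := min 1 (2 * x 0), j := collar_collapse (x j)))) f"
    by (rule torus_homotopic_reparam[OF j(1,2) S _ f]) simp
  fix x assume x: "x \<in> topspace (cube n)"
  then have x0: "0 \<le> x 0" "x 0 \<le> 1" using n by (auto simp: topspace_cube)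
  note cb = collar_bounds[of "x j"]
  have face: "f (x(0 := s, j := r)) = y" if "0 \<le> s" "s \<le> 1" "r = 0 \<or> r = 1" for s r
    using that j n x by (intro torus_loop_face[OF f(2), of _ j] cube_update) auto
  have top: "f (x(0 := 1, j := collar_collapse (x j))) = y"
    using j n x cb by (intro torus_loop_end[OF f(2)] cube_update) auto
  consider "collar_height (x j) = 1" | "collar_collapse (x j) = 0 \<or> collar_collapse (x j) = 1"
    using collar_cases by blast
  then show "peel j f x = f (x(0 := min 1 (2 * x 0), j := collar_collapse (x j)))"
  proof cases
    case 1
    then show ?thesis using x0 j face top by (auto simp: peel_def spheroid_concat_def min_absorb1 min_absorb2)
  next
    case 2
    then show ?thesis using x0 j cb face by (auto simp: peel_def spheroid_concat_def)
  qed
qed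

text \<open>As \<open>peel j f\<close> stands for \<open>f\<close> times the inverse of its restriction to the face \<open>x j = 0\<close>,
multiplication by this restriction gives back \<open>f\<close>. On the faces orthogonal to \<open>j\<close> the
map \<open>f\<close> need not be constant, so the homotopy is one of torus loops with no condition on faces.\<close>

lemma torus_homotopic_peel_concat:
  assumes j: "1 \<le> j" "j < n" and f: "continuous_map (cube n) Y f" "torus_loop n y {} f"
  shows "torus_homotopic n Y y {} (spheroid_concat (peel j f) (\<lambda>x. f (x(j := 0)))) f"
proof (rule homotopic_with_trans)
  \<comment> \<open>One homotopy does two things as \<open>t\<close> grows: \<open>max (collar_height (x j)) t\<close> raises the collar to
    full height, and the outer \<open>max _ t\<close> in \<open>?B\<close> and \<open>?R\<close> cancels the return path against the
    appended one, both being cut off below level \<open>t\<close>. At \<open>t = 1\<close> only a quarter of the time is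
    spent away from the base point, and \<open>torus_homotopic_reparam\<close> with factor \<open>4\<close> finishes.\<close>
  let ?A = "\<lambda>t x. x(0 := min (x 0) (max (collar_height (x j)) t), j := collar_collapse (x j))"
  let ?B = "\<lambda>t x. x(0 := max (min (1 - x 0) (max (collar_height (x j)) t)) t, j := 0)"
  let ?R = "\<lambda>t x. x(0 := max (x 0) t, j := 0)"
  let ?P = "prod_topology (top_of_set {0..1::real}) (cube n)"
  let ?h = "\<lambda>t. spheroid_concat (spheroid_concat (\<lambda>x. f (?A t x)) (\<lambda>x. f (?B t x))) (\<lambda>x. f (?R t x))"
  have n: "0 < n" using j by simp
  have j0: "j \<noteq> 0" using j by simp
  have b: "0 \<le> x 0" "x 0 \<le> 1" if "x \<in> topspace (cube n)" for x
    using that n by (auto simp: topspace_cube)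
  have A: "?A t x \<in> topspace (cube n)" and B: "?B t x \<in> topspace (cube n)" and R: "?R t x \<in> topspace (cube n)"
    if "x \<in> topspace (cube n)" "0 \<le> t" "t \<le> 1" for x t
    using that n j collar_bounds[of "x j"] b[OF that(1)]
    by (auto intro!: cube_update simp: min_le_iff_disj le_max_iff_disj)
  have c: "continuous_map ?P euclideanreal (\<lambda>a. snd a i)" if "i < n" for i
    using continuous_map_cube_component[OF continuous_map_snd that] .
  have t: "continuous_map ?P euclideanreal fst"
    using continuous_map_into_fulltopology continuous_map_fst by blast
  have bP: "0 \<le> snd a 0" "snd a 0 \<le> 1" "0 \<le> fst a" "fst a \<le> 1" if "a \<in> topspace ?P" for a
    using that n by (auto simp: topspace_cube)
  note cont = continuous_map_cube_substitution continuous_map_constant_family f continuous_map_cube_update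
     continuous_map_snd continuous_intros continuous_map_collar c t
  have cA: "continuous_map ?P Y (\<lambda>(t, x). f (?A t x))"
  proof -
    have "continuous_map ?P Y (\<lambda>(t, x). (\<lambda>(t, x). f x) (t, ?A t x))"
      using n j bP by (intro cont) (auto simp: collar_bounds min_le_iff_disj le_max_iff_disj)
    then show ?thesis by (simp only: split)
  qed
  have cB: "continuous_map ?P Y (\<lambda>(t, x). f (?B t x))"
  proof -
    have "continuous_map ?P Y (\<lambda>(t, x). (\<lambda>(t, x). f x) (t, ?B t x))"
      using n j bP by (intro cont) (auto simp: collar_bounds min_le_iff_disj le_max_iff_disj)
    then show ?thesis by (simp only: split)
  qed
  have cR: "continuous_map ?P Y (\<lambda>(t, x). f (?R t x))"
  proof -
    have "continuous_map ?P Y (\<lambda>(t, x). (\<lambda>(t, x). f x) (t, ?R t x))"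
      using n j bP by (intro cont) (auto simp: collar_bounds min_le_iff_disj le_max_iff_disj)
    then show ?thesis by (simp only: split)
  qed
  have "continuous_map ?P Y
      (\<lambda>(t, x). spheroid_concat (\<lambda>x. (\<lambda>(t, x). f (?A t x)) (t, x)) (\<lambda>x. (\<lambda>(t, x). f (?B t x)) (t, x)) x)"
  proof (rule continuous_map_spheroid_concat[OF n cA cB])
    fix t :: real and x assume "t \<in> topspace (top_of_set {0..1})" and x: "x \<in> topspace (cube n)"
    then have "0 \<le> t" "t \<le> 1" by auto
    then have "max (min 1 (max (collar_height (x j)) t)) t = max (collar_height (x j)) t"
      "min 1 (max (collar_height (x j)) t) = max (collar_height (x j)) t"
      using collar_bounds[of "x j"] by auto
    then show "(\<lambda>(t, x). f (?A t x)) (t, x(0 := 1)) = (\<lambda>(t, x). f (?B t x)) (t, x(0 := 0))"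
      using torus_loop_collar[OF f(2) x j, of "max (collar_height (x j)) t"] j0 \<open>t \<le> 1\<close>
      by (simp add: collar_bounds)
  qed
  then have cAB: "continuous_map ?P Y (\<lambda>(t, x). spheroid_concat (\<lambda>x. f (?A t x)) (\<lambda>x. f (?B t x)) x)"
    by (simp only: split)
  have "continuous_map ?P Y (\<lambda>(t, x). spheroid_concat
      (\<lambda>x. (\<lambda>(t, x). spheroid_concat (\<lambda>x. f (?A t x)) (\<lambda>x. f (?B t x)) x) (t, x))
      (\<lambda>x. (\<lambda>(t, x). f (?R t x)) (t, x)) x)"
  proof (rule continuous_map_spheroid_concat[OF n cAB cR])
    fix t :: real and x assume "t \<in> topspace (top_of_set {0..1})" and x: "x \<in> topspace (cube n)"
    then have "0 \<le> t" "t \<le> 1" by auto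
    then have "max (min 0 (max (collar_height (x j)) t)) t = t" "max 0 t = t"
      using collar_bounds[of "x j"] by auto
    then show "(\<lambda>(t, x). spheroid_concat (\<lambda>x. f (?A t x)) (\<lambda>x. f (?B t x)) x) (t, x(0 := 1))
        = (\<lambda>(t, x). f (?R t x)) (t, x(0 := 0))"
      using j0 by (simp add: spheroid_concat_def)
  qed
  then have ch: "continuous_map ?P Y (\<lambda>(t, x). ?h t x)"
    by (simp only: split)
  show "torus_homotopic n Y y {} (spheroid_concat (peel j f) (\<lambda>x. f (x(j := 0)))) (?h 1)"
  proof (rule torus_homotopicI[OF ch])
    show "(\<lambda>(t, x). ?h t x) (0, x) = spheroid_concat (peel j f) (\<lambda>x. f (x(j := 0))) x"
      if "x \<in> topspace (cube n)" for x
      using b[OF that] j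
      by (auto simp: spheroid_concat_def peel_def collar_bounds max_absorb1 fun_upd_idem)
    fix t :: real assume t: "0 \<le> t" "t \<le> 1"
    have pA: "f (?A t (x(i := 0))) = f (?A t (x(i := 1)))"
     and pB: "f (?B t (x(i := 0))) = f (?B t (x(i := 1)))"
     and pR: "f (?R t (x(i := 0))) = f (?R t (x(i := 1)))"
      if x: "x \<in> topspace (cube n)" and i: "1 \<le> i" "i < n" for x i
    proof -
      have X: "x(0 := r) \<in> topspace (cube n)" if "0 \<le> r" "r \<le> 1" for r
        using that x n by (intro cube_update) auto
      have "f (?A t (x(i := 0))) = f (?A t (x(i := 1))) \<and> f (?B t (x(i := 0))) = f (?B t (x(i := 1)))
          \<and> f (?R t (x(i := 0))) = f (?R t (x(i := 1)))"
      proof (cases "i = j")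
        case True
        have "0 \<le> min (x 0) t" "min (x 0) t \<le> 1" using b[OF x] t by auto
        then show ?thesis
          using torus_loop_periodic[OF f(2) X i] True i t by simp
      next
        case False
        then show ?thesis
          using torus_loop_periodic[OF f(2) A[OF x t] i] torus_loop_periodic[OF f(2) B[OF x t] i]
            torus_loop_periodic[OF f(2) R[OF x t] i] i j by (simp add: fun_upd_twist)
      qed
      then show "f (?A t (x(i := 0))) = f (?A t (x(i := 1)))" "f (?B t (x(i := 0))) = f (?B t (x(i := 1)))"
        "f (?R t (x(i := 0))) = f (?R t (x(i := 1)))" by blast+
    qed
    show "torus_loop n y {} (\<lambda>x. (\<lambda>(t, x). ?h t x) (t, x))"
      unfolding split
    proof (rule torus_loop_spheroid_concatI[OF n])
      fix x assume x: "x \<in> topspace (cube n)"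
      show "f (?R t x) = y" if "x 0 = 1"
        using that j t by (intro torus_loop_end[OF f(2) R[OF x t]]) auto
      show "spheroid_concat (\<lambda>x. f (?A t x)) (\<lambda>x. f (?B t x)) x = y" if "x 0 = 0"
        using that torus_loop_end[OF f(2) A[OF x t]] j t
        by (auto simp: spheroid_concat_def fun_upd_idem collar_bounds min_absorb1 le_max_iff_disj)
      fix i assume i: "1 \<le> i" "i < n"
      show "f (?R t (x(i := 0))) = f (?R t (x(i := 1)))" using pR[OF x i] .
      have L: "x(0 := 2 * x 0) \<in> topspace (cube n)" if "x 0 \<le> 1/2"
        using that b[OF x] n x by (auto intro!: cube_update)
      have H: "x(0 := 2 * x 0 - 1) \<in> topspace (cube n)" if "\<not> x 0 \<le> 1/2"
        using that b[OF x] n x by (auto intro!: cube_update)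
      show "spheroid_concat (\<lambda>x. f (?A t x)) (\<lambda>x. f (?B t x)) (x(i := 0)) =
            spheroid_concat (\<lambda>x. f (?A t x)) (\<lambda>x. f (?B t x)) (x(i := 1))"
        using pA[OF L i] pB[OF H i] i
        by (simp add: spheroid_concat_def fun_upd_twist)
    qed auto
  qed auto
  have "torus_homotopic n Y y {} (\<lambda>x. f (x(0 := min 1 (4 * x 0), j := collar_collapse (x j)))) f"
    by (rule torus_homotopic_reparam[OF j _ _ f]) auto
  moreover have "f (x(0 := min 1 (4 * x 0), j := collar_collapse (x j))) = ?h 1 x"
    if x: "x \<in> topspace (cube n)" for x
  proof -
    have top: "f (x(0 := 1, j := r)) = y" if "0 \<le> r" "r \<le> 1" for r
      using that j n x by (intro torus_loop_end[OF f(2)] cube_update) auto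
    show ?thesis
      using b[OF x] j top collar_bounds[of "x j"]
      by (auto simp: spheroid_concat_def max_absorb2 min_def)
  qed
  ultimately show "torus_homotopic n Y y {} (?h 1) f"
    by (rule torus_homotopic_eq) auto
qed

section \<open>Lifting spheroids and torus loops\<close>

lemma boundary_iff_torus_loop:
  assumes "1 \<le> n"
  shows "(\<forall>x\<in>cube_boundary n. h x = y) \<longleftrightarrow> torus_loop n y {1..<n} h"
proof
  assume h: "\<forall>x\<in>cube_boundary n. h x = y"
  have bd: "h x = y" if "x \<in> topspace (cube n)" "i < n" "x i = 0 \<or> x i = 1" for x i
    using h that by (auto simp: cube_boundary_def)
  show "torus_loop n y {1..<n} h"
  proof (rule torus_loopI)
    fix x j assume x: "x \<in> topspace (cube n)" and j: "1 \<le> j" "j < n"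
    show "h (x(j := 0)) = h (x(j := 1))"
      using bd[OF cube_update[OF x j(2)] j(2), of 0] bd[OF cube_update[OF x j(2)] j(2), of 1] by simp
  qed (use assms bd in auto)
next
  assume h: "torus_loop n y {1..<n} h"
  show "\<forall>x\<in>cube_boundary n. h x = y"
  proof
    fix x assume "x \<in> cube_boundary n"
    then obtain i where x: "x \<in> topspace (cube n)" and i: "i < n" "x i = 0 \<or> x i = 1"
      by (auto simp: cube_boundary_def)
    show "h x = y"
    proof (cases "i = 0")
      case True
      then show ?thesis using torus_loop_end[OF h x] i by simp
    next
      case False
      then show ?thesis using torus_loop_face[OF h x, of i] i by simp
    qed
  qed
qed

lemma spheroids_eq_torus_loops:
  "1 \<le> n \<Longrightarrow> f \<in> spheroids n Z z \<longleftrightarrow> continuous_map (cube n) Z f \<and> torus_loop n z {1..<n} f"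
  by (simp add: spheroids_def boundary_iff_torus_loop)

lemma spheroid_homotopy_eq_torus_homotopic:
  "1 \<le> n \<Longrightarrow> (f, g) \<in> spheroid_homotopy n Z z \<longleftrightarrow> torus_homotopic n Z z {1..<n} f g"
  by (simp add: spheroid_homotopy_def boundary_iff_torus_loop)

text \<open>For \<open>S = {1..<n}\<close> this expresses that \<open>p\<close> is surjective on \<open>\<pi>\<^sub>n\<close>, and for \<open>S = {}\<close> that it is
surjective on the Fox group, both in terms of maps on the cube.\<close>

definition lifts_torus_loops ::
    "nat \<Rightarrow> nat set \<Rightarrow> 'b topology \<Rightarrow> 'b \<Rightarrow> 'a topology \<Rightarrow> 'a \<Rightarrow> ('b \<Rightarrow> 'a) \<Rightarrow> bool" where
  "lifts_torus_loops n S Z z Y y p \<longleftrightarrow>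
     (\<forall>f. continuous_map (cube n) Y f \<and> torus_loop n y S f \<longrightarrow>
        (\<exists>F. continuous_map (cube n) Z F \<and> torus_loop n z S F \<and> torus_homotopic n Y y S (p \<circ> F) f))"

lemma lifts_torus_loopsD:
  assumes "lifts_torus_loops n S Z z Y y p" "continuous_map (cube n) Y f" "torus_loop n y S f"
  obtains F where "continuous_map (cube n) Z F" "torus_loop n z S F" "torus_homotopic n Y y S (p \<circ> F) f"
  using assms unfolding lifts_torus_loops_def by metis

lemma spheroid_concat_compose: "p \<circ> spheroid_concat f g = spheroid_concat (p \<circ> f) (p \<circ> g)"
  by (auto simp: spheroid_concat_def)

lemma peel_compose: "p \<circ> peel j f = peel j (p \<circ> f)"
  by (auto simp: peel_def spheroid_concat_def)

text \<open>A spheroid \<open>f\<close> is in particular a torus loop, so it has a lift \<open>F\<close> as such. Peeling \<open>F\<close> in every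
coordinate turns it into a spheroid. The operation commutes with composition by \<open>p\<close>, applies to
homotopies, and does not change the class of \<open>f\<close>, whose faces are constant already; so the peeled
\<open>F\<close> still lifts \<open>f\<close>, and the homotopy becomes one relative to the boundary.\<close>

lemma lifts_torus_loops_imp_lifts_spheroids:
  assumes lifts: "lifts_torus_loops n {} Z z Y y p"
  shows "lifts_torus_loops n {1..<n} Z z Y y p"
  unfolding lifts_torus_loops_def
proof (intro allI impI)
  fix f assume "continuous_map (cube n) Y f \<and> torus_loop n y {1..<n} f"
  then have f: "continuous_map (cube n) Y f" "torus_loop n y {1..<n} f" by auto
  have "\<exists>F. continuous_map (cube n) Z F \<and> torus_loop n z S F \<and> torus_homotopic n Y y S (p \<circ> F) f"
    if "finite S" "S \<subseteq> {1..<n}" for S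
    using that
  proof (induction S rule: finite_induct)
    case empty
    show ?case using lifts f(1) torus_loop_mono[OF f(2), of "{}"] unfolding lifts_torus_loops_def by blast
  next
    case (insert j S)
    then have "S \<subseteq> {1..<n}" by simp
    then obtain F where F: "continuous_map (cube n) Z F" "torus_loop n z S F" "torus_homotopic n Y y S (p \<circ> F) f"
      using insert.IH by blast
    from insert have j: "1 \<le> j" "j < n" and S: "0 \<notin> S" "0 \<notin> insert j S" by auto
    have "torus_homotopic n Y y (insert j S) (p \<circ> peel j F) (peel j f)"
      unfolding peel_compose by (rule torus_homotopic_peel[OF j S(1) F(3)])
    moreover have "torus_homotopic n Y y (insert j S) (peel j f) f"
      using torus_homotopic_peel_trivial_face[OF j insertI1 S(2) f(1)] torus_loop_mono[OF f(2)] insert(4) by blast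
    ultimately have "torus_homotopic n Y y (insert j S) (p \<circ> peel j F) f"
      by (rule homotopic_with_trans)
    then show ?case
      using continuous_map_peel_single[OF j F(1,2)] torus_loop_peel[OF j S(1) F(2)] by blast
  qed
  then show "\<exists>F. continuous_map (cube n) Z F \<and> torus_loop n z {1..<n} F \<and> torus_homotopic n Y y {1..<n} (p \<circ> F) f"
    by blast
qed

definition ignores_coordinates :: "nat \<Rightarrow> nat set \<Rightarrow> ((nat \<Rightarrow> real) \<Rightarrow> 'a) \<Rightarrow> bool" where
  "ignores_coordinates n E f \<longleftrightarrow>
     (\<forall>x\<in>topspace (cube n). \<forall>x'\<in>topspace (cube n). (\<forall>i<n. i \<notin> E \<longrightarrow> x i = x' i) \<longrightarrow> f x = f x')"

lemma ignores_coordinatesD: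
  assumes "ignores_coordinates n E f" "x \<in> topspace (cube n)" "x' \<in> topspace (cube n)"
    and "\<And>i. i < n \<Longrightarrow> i \<notin> E \<Longrightarrow> x i = x' i"
  shows "f x = f x'"
  using assms unfolding ignores_coordinates_def by blast

lemma ignores_coordinates_empty: "ignores_coordinates n {} f"
proof -
  have "x = x'" if "x \<in> topspace (cube n)" "x' \<in> topspace (cube n)" "\<forall>i<n. x i = x' i" for x x'
    using that extensionalityI[of x "{..<n}" x'] by (simp add: topspace_cube)
  then show ?thesis unfolding ignores_coordinates_def by fastforce
qed

lemma peel_apply:
  assumes "1 \<le> j"
  shows "peel j f x =
    (if x 0 \<le> 1/2 then f (x(0 := min (2 * x 0) (collar_height (x j)), j := collar_collapse (x j)))
     else f (x(0 := min (1 - (2 * x 0 - 1)) (collar_height (x j)), j := 0)))"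
proof -
  have "j \<noteq> 0" using assms by simp
  then show ?thesis by (simp only: peel_def spheroid_concat_def fun_upd_upd fun_upd_apply if_False if_True refl)
qed

lemma ignores_coordinates_peel:
  assumes j: "1 \<le> j" "j < n" "j \<notin> E" and E: "0 \<notin> E" and f: "ignores_coordinates n E f"
  shows "ignores_coordinates n E (peel j f)"
  unfolding ignores_coordinates_def
proof (intro ballI impI)
  fix x x' assume x: "x \<in> topspace (cube n)" "x' \<in> topspace (cube n)"
    and eq: "\<forall>i<n. i \<notin> E \<longrightarrow> x i = x' i"
  have n: "0 < n" using j by simp
  have e: "x 0 = x' 0" "x j = x' j" using eq E j by auto
  have b: "0 \<le> x 0" "x 0 \<le> 1" using x n by (auto simp: topspace_cube)
  have upd: "f (x(0 := a, j := c)) = f (x'(0 := a, j := c))" if "0 \<le> a" "a \<le> 1" "0 \<le> c" "c \<le> 1" for a c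
  proof -
    have "x(0 := a, j := c) \<in> topspace (cube n)" "x'(0 := a, j := c) \<in> topspace (cube n)"
      using that x j n by (auto intro!: cube_update)
    then show ?thesis using eq by (intro ignores_coordinatesD[OF f]) simp_all
  qed
  show "peel j f x = peel j f x'"
    unfolding peel_apply[OF j(1)] e[symmetric]
  proof (rule if_cong[OF refl])
    show "f (x(0 := min (2 * x 0) (collar_height (x j)), j := collar_collapse (x j))) =
          f (x'(0 := min (2 * x 0) (collar_height (x j)), j := collar_collapse (x j)))" if "x 0 \<le> 1/2"
      by (rule upd) (use that b collar_bounds[of "x j"] in auto)
    show "f (x(0 := min (1 - (2 * x 0 - 1)) (collar_height (x j)), j := 0)) =
          f (x'(0 := min (1 - (2 * x 0 - 1)) (collar_height (x j)), j := 0))" if "\<not> x 0 \<le> 1/2"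
      by (rule upd) (use that b collar_bounds[of "x j"] in auto)
  qed
qed

lemma ignores_coordinates_collapse:
  assumes "j < n" "ignores_coordinates n E f"
  shows "ignores_coordinates n (insert j E) (\<lambda>x. f (x(j := 0)))"
  unfolding ignores_coordinates_def
proof (intro ballI impI)
  fix x x' assume x: "x \<in> topspace (cube n)" "x' \<in> topspace (cube n)"
    and eq: "\<forall>i<n. i \<notin> insert j E \<longrightarrow> x i = x' i"
  then have "x(j := 0) \<in> topspace (cube n)" "x'(j := 0) \<in> topspace (cube n)"
    using assms by (auto intro!: cube_update)
  then show "f (x(j := 0)) = f (x'(j := 0))"
    using eq by (intro ignores_coordinatesD[OF assms(2)]) simp_all
qed

lemma torus_loop_collapse:
  assumes j: "1 \<le> j" "j < n" and S: "0 \<notin> S" and f: "torus_loop n y S f"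
  shows "torus_loop n y S (\<lambda>x. f (x(j := 0)))"
proof (rule torus_loopI)
  fix x assume x: "x \<in> topspace (cube n)"
  have X: "x(j := 0) \<in> topspace (cube n)" using x j by (auto intro: cube_update)
  show "f (x(j := 0)) = y" if "x 0 = 0 \<or> x 0 = 1"
    using that j by (intro torus_loop_end[OF f X]) auto
  show "f (x(i := 0, j := 0)) = f (x(i := 1, j := 0))" if "1 \<le> i" "i < n" for i
    using torus_loop_periodic[OF f X that] by (cases "i = j") (simp_all add: fun_upd_twist)
  show "f (x(j := 0)) = y" if "i \<in> S" "x i = 0 \<or> x i = 1" for i
    using that by (intro torus_loop_face[OF f X, of i]) auto
qed

lemma continuous_map_collapse:
  assumes "j < n" "continuous_map (cube n) Y f"
  shows "continuous_map (cube n) Y (\<lambda>x. f (x(j := 0)))"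
proof -
  have "continuous_map (cube n) (cube n) (\<lambda>x. x(j := 0))"
    using continuous_map_cube_update[OF continuous_map_id assms(1), of "\<lambda>_. 0"] by simp
  from continuous_map_compose[OF this assms(2)] show ?thesis by (simp add: o_def)
qed

text \<open>A torus loop in which each coordinate other than \<open>0\<close> is either ignored or trivial on its faces is
a spheroid on the cube of the remaining coordinates, pulled back along a projection. That spheroid
can be lifted, and the pullback of its lift is a lift. The bijection \<open>\<sigma>\<close> below renumbers the
remaining coordinates \<open>insert 0 S\<close> so that coordinate \<open>0\<close>, along which loops are composed, keeps its
number, and \<open>\<tau>\<close> is its inverse.\<close>

lemma spheroid_lifting_over_ignored_coordinates:
  assumes spheroids: "lifts_torus_loops (Suc (card S)) {1..<Suc (card S)} Z z Y y p"
    and S: "S \<subseteq> {1..<n}" and n: "1 \<le> n" and cover: "{1..<n} \<subseteq> S \<union> E"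
    and f: "continuous_map (cube n) Y f" "torus_loop n y S f" "ignores_coordinates n E f"
  shows "\<exists>F. continuous_map (cube n) Z F \<and> torus_loop n z {} F \<and> torus_homotopic n Y y {} (p \<circ> F) f"
proof -
  define m where "m = Suc (card S)"
  have finS: "finite S" using S finite_subset by blast
  obtain s where s: "bij_betw s {0..<card S} S" using ex_bij_betw_nat_finite[OF finS] by blast
  define \<sigma> where "\<sigma> i = (case i of 0 \<Rightarrow> 0 | Suc k \<Rightarrow> s k)" for i
  define \<tau> where "\<tau> j = (if j = 0 then 0 else Suc (inv_into {0..<card S} s j))" for j
  have \<sigma>: "\<sigma> i \<in> insert 0 S" if "i < m" for i
    using that s by (auto simp: \<sigma>_def m_def bij_betw_def split: nat.splits)
  have \<tau>: "\<tau> j < m" "\<sigma> (\<tau> j) = j" if "j \<in> insert 0 S" for j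
  proof -
    have "inv_into {0..<card S} s j < card S" "s (inv_into {0..<card S} s j) = j" if "j \<in> S"
      using that s bij_betw_apply[OF bij_betw_inv_into[OF s] that] bij_betw_inv_into_right[OF s that] by auto
    then show "\<tau> j < m" "\<sigma> (\<tau> j) = j" using that by (auto simp: \<tau>_def \<sigma>_def m_def)
  qed
  have \<tau>\<sigma>: "\<tau> (\<sigma> i) = i" if "i < m" for i
  proof (cases i)
    case (Suc k)
    then have k: "k \<in> {0..<card S}" using that by (simp add: m_def)
    then have "s k \<in> S" using s by (auto simp: bij_betw_def)
    then have "s k \<noteq> 0" using S by auto
    then show ?thesis using Suc bij_betw_inv_into_left[OF s k] by (simp add: \<sigma>_def \<tau>_def)
  qed (simp add: \<sigma>_def \<tau>_def)
  \<comment> \<open>Ignored coordinates are filled in with \<open>0\<close>; any number in the unit interval would do.\<close>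
  define expand where "expand x = (\<lambda>j\<in>{..<n}. if j \<in> insert 0 S then x (\<tau> j) else 0)" for x :: "nat \<Rightarrow> real"
  define restr where "restr x = (\<lambda>i\<in>{..<m}. x (\<sigma> i))" for x :: "nat \<Rightarrow> real"
  have \<sigma>n: "\<sigma> i < n" if "i < m" for i using \<sigma>[OF that] S n by auto
  have proj: "continuous_map (cube k) (top_of_set {0..1}) (\<lambda>x. x i)" if "i < k" for i k
    unfolding cube_def using that by (intro continuous_map_product_projection) auto
  have expand: "continuous_map (cube m) (cube n) expand"
  proof -
    have "continuous_map (cube m) (top_of_set {0..1}) (\<lambda>x. expand x j)" if "j < n" for j
      using that proj[OF \<tau>(1)] by (cases "j \<in> insert 0 S") (auto simp: expand_def)
    then show ?thesis
      unfolding cube_def[of n] continuous_map_componentwise by (auto simp: expand_def)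
  qed
  have restr: "continuous_map (cube n) (cube m) restr"
  proof -
    have "continuous_map (cube n) (top_of_set {0..1}) (\<lambda>x. restr x i)" if "i < m" for i
      using that proj[OF \<sigma>n] by (auto simp: restr_def)
    then show ?thesis
      unfolding cube_def[of m] continuous_map_componentwise by (auto simp: restr_def)
  qed
  have m: "1 \<le> m" by (simp add: m_def)
  have "\<forall>x\<in>cube_boundary m. (f \<circ> expand) x = y"
  proof
    fix x assume "x \<in> cube_boundary m"
    then obtain i where x: "x \<in> topspace (cube m)" and i: "i < m" "x i = 0 \<or> x i = 1"
      by (auto simp: cube_boundary_def)
    have X: "expand x \<in> topspace (cube n)" using expand x by (auto simp: continuous_map_def)
    have e: "expand x (\<sigma> i) = x i" using \<sigma>[OF i(1)] \<sigma>n[OF i(1)] \<tau>\<sigma>[OF i(1)] by (auto simp: expand_def)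
    show "(f \<circ> expand) x = y"
    proof (cases "\<sigma> i = 0")
      case True
      then show ?thesis using torus_loop_end[OF f(2) X] e i by simp
    next
      case False
      then show ?thesis using torus_loop_face[OF f(2) X, of "\<sigma> i"] \<sigma>[OF i(1)] e i by simp
    qed
  qed
  then have loop: "torus_loop m y {1..<m} (f \<circ> expand)"
    by (rule iffD1[OF boundary_iff_torus_loop[OF m]])
  obtain G where G: "continuous_map (cube m) Z G" "torus_loop m z {1..<m} G"
      "torus_homotopic m Y y {1..<m} (p \<circ> G) (f \<circ> expand)"
    by (rule lifts_torus_loopsD[OF spheroids[folded m_def] continuous_map_compose[OF expand f(1)] loop])
  have restr_loop: "torus_loop n u {} (h \<circ> restr)" if h: "torus_loop m u {1..<m} h" for u :: 'c and h
  proof (rule torus_loopI)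
    fix x assume x: "x \<in> topspace (cube n)"
    have bd: "(h \<circ> restr) x = u" if "x \<in> topspace (cube n)" "j \<in> insert 0 S" "x j = 0 \<or> x j = 1" for x j
    proof -
      have "restr x \<in> topspace (cube m)" using restr that(1) by (auto simp: continuous_map_def)
      moreover have "restr x (\<tau> j) = x j" using \<tau>[OF that(2)] by (simp add: restr_def)
      ultimately have "restr x \<in> cube_boundary m" using \<tau>[OF that(2)] that(3) by (auto simp: cube_boundary_def)
      then have "h (restr x) = u" using iffD2[OF boundary_iff_torus_loop[OF m] h] by (rule bspec[rotated])
      then show ?thesis by simp
    qed
    show "(h \<circ> restr) x = u" if "x 0 = 0 \<or> x 0 = 1"
      using bd[OF x, of 0] that by simp
    \<comment> \<open>The faces of a remaining coordinate go to the base point; an ignored one is not seen at all.\<close>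
    show "(h \<circ> restr) (x(j := 0)) = (h \<circ> restr) (x(j := 1))" if j: "1 \<le> j" "j < n" for j
    proof (cases "j \<in> S")
      case True
      then show ?thesis
        using bd[OF cube_update[OF x j(2)], of 0 j] bd[OF cube_update[OF x j(2)], of 1 j] by simp
    next
      case False
      have "\<sigma> i \<noteq> j" if "i < m" for i using \<sigma>[OF that] False j by auto
      then have "restr (x(j := 0)) = restr (x(j := 1))" by (auto simp: restr_def restrict_def)
      then show ?thesis by simp
    qed
  qed simp
  have "torus_homotopic n Y y {} ((p \<circ> G) \<circ> restr) ((f \<circ> expand) \<circ> restr)"
    by (rule homotopic_with_compose_continuous_map_right[OF G(3) restr]) (rule restr_loop)
  then have "torus_homotopic n Y y {} (p \<circ> (G \<circ> restr)) f"
  proof (rule torus_homotopic_eq)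
    fix x assume x: "x \<in> topspace (cube n)"
    have R: "restr x \<in> topspace (cube m)" using restr x by (auto simp: continuous_map_def)
    have "expand (restr x) \<in> topspace (cube n)" using expand R by (auto simp: continuous_map_def)
    moreover have "expand (restr x) i = x i" if "i < n" "i \<notin> E" for i
    proof -
      have "i \<in> {1..<n}" if "i \<noteq> 0" using that \<open>i < n\<close> by simp
      then have "i \<in> insert 0 S" using \<open>i \<notin> E\<close> cover by blast
      then show ?thesis using \<tau>[of i] that(1) by (simp add: expand_def restr_def)
    qed
    ultimately show "(f \<circ> expand \<circ> restr) x = f x"
      using ignores_coordinatesD[OF f(3) _ x] by simp
  qed simp
  moreover have "continuous_map (cube n) Z (G \<circ> restr)"
    using continuous_map_compose[OF restr G(1)] .
  ultimately show ?thesis using restr_loop[OF G(2)] by blast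
qed

text \<open>Induction on the number of coordinates that are neither trivial on their faces (those in \<open>S\<close>) nor
ignored (those in \<open>E\<close>). For such a coordinate \<open>j\<close>, the loop \<open>f\<close> is homotopic to \<open>peel j f\<close>, which
is trivial on the faces of \<open>j\<close>, followed by the restriction of \<open>f\<close> to \<open>x j = 0\<close>, which ignores
\<open>j\<close>. Both factors have lifts by induction, and the concatenation of these lifts \<open>f\<close>. Spheroids of
all dimensions up to \<open>n\<close> occur at the bottom of the recursion.\<close>

lemma lifts_spheroids_imp_lifts_torus_loops:
  assumes p: "continuous_map Z Y p" "p z = y" and n: "1 \<le> n"
    and spheroids: "\<And>m. 1 \<le> m \<Longrightarrow> lifts_torus_loops m {1..<m} Z z Y y p"
  shows "lifts_torus_loops n {} Z z Y y p"
proof -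
  have n0: "0 < n" using n by simp
  have "\<exists>F. continuous_map (cube n) Z F \<and> torus_loop n z {} F \<and> torus_homotopic n Y y {} (p \<circ> F) f"
    if "S \<subseteq> {1..<n}" "0 \<notin> E" "continuous_map (cube n) Y f" "torus_loop n y S f" "ignores_coordinates n E f"
    for S E f
    using that
  proof (induction "card ({1..<n} - (S \<union> E))" arbitrary: S E f rule: less_induct)
    case less
    note f = less.prems(3-5)
    show ?case
    proof (cases "{1..<n} \<subseteq> S \<union> E")
      case True
      show ?thesis
        by (rule spheroid_lifting_over_ignored_coordinates[OF spheroids less.prems(1) n True f]) simp
    next
      case False
      then obtain j where J: "j \<in> {1..<n}" "j \<notin> S \<union> E" by blast
      then have j: "1 \<le> j" "j < n" "j \<notin> S" "j \<notin> E" by auto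
      have S: "0 \<notin> S" using less.prems(1) by auto
      have f0: "torus_loop n y {} f" using torus_loop_mono[OF f(2)] by simp
      have "j \<in> {1..<n} - (S \<union> E)" using J by blast
      then have "{1..<n} - (insert j S \<union> E) \<subset> {1..<n} - (S \<union> E)"
        and "{1..<n} - (S \<union> insert j E) \<subset> {1..<n} - (S \<union> E)" by blast+
      then have c: "card ({1..<n} - (insert j S \<union> E)) < card ({1..<n} - (S \<union> E))"
        "card ({1..<n} - (S \<union> insert j E)) < card ({1..<n} - (S \<union> E))"
        by (simp_all only: psubset_card_mono finite_Diff finite_atLeastLessThan)
      have "insert j S \<subseteq> {1..<n}" "0 \<notin> insert j E" using j less.prems(1,2) by auto
      have "\<exists>F. continuous_map (cube n) Z F \<and> torus_loop n z {} F \<and> torus_homotopic n Y y {} (p \<circ> F) (peel j f)"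
        by (rule less.hyps[OF c(1) \<open>insert j S \<subseteq> {1..<n}\<close> less.prems(2) continuous_map_peel_single[OF j(1,2) f(1,2)]
            torus_loop_peel[OF j(1,2) S f(2)] ignores_coordinates_peel[OF j(1,2,4) less.prems(2) f(3)]])
      then obtain F where F: "continuous_map (cube n) Z F" "torus_loop n z {} F"
          "torus_homotopic n Y y {} (p \<circ> F) (peel j f)"
        by (elim exE conjE) (rule that)
      have "\<exists>G. continuous_map (cube n) Z G \<and> torus_loop n z {} G \<and>
          torus_homotopic n Y y {} (p \<circ> G) (\<lambda>x. f (x(j := 0)))"
        by (rule less.hyps[OF c(2) less.prems(1) \<open>0 \<notin> insert j E\<close> continuous_map_collapse[OF j(2) f(1)]
            torus_loop_collapse[OF j(1,2) S f(2)] ignores_coordinates_collapse[OF j(2) f(3)]])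
      then obtain G where G: "continuous_map (cube n) Z G" "torus_loop n z {} G"
          "torus_homotopic n Y y {} (p \<circ> G) (\<lambda>x. f (x(j := 0)))"
        by (elim exE conjE) (rule that)
      have "torus_homotopic n Y y {} (p \<circ> spheroid_concat F G) (spheroid_concat (peel j f) (\<lambda>x. f (x(j := 0))))"
        unfolding spheroid_concat_compose
        by (rule torus_homotopic_spheroid_concat[OF n0 _ F(3) G(3)]) simp
      from homotopic_with_trans[OF this torus_homotopic_peel_concat[OF j(1,2) f(1) f0]]
      have "torus_homotopic n Y y {} (p \<circ> spheroid_concat F G) f" .
      moreover have "torus_loop n z {} (spheroid_concat F G)"
        using torus_loop_spheroid_concat[OF n0 _ F(2) G(2)] by simp
      moreover have "continuous_map (cube n) Z (spheroid_concat F G)"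
      proof -
        have "continuous_map (prod_topology (discrete_topology UNIV) (cube n)) Z
           (\<lambda>(w::nat, x). spheroid_concat (\<lambda>x. (\<lambda>(w, x). F x) (w, x)) (\<lambda>x. (\<lambda>(w, x). G x) (w, x)) x)"
          using n0 torus_loop_end[OF F(2)] torus_loop_end[OF G(2)]
          by (intro continuous_map_spheroid_concat continuous_map_constant_family F(1) G(1))
            (auto simp: cube_update)
        from continuous_map_slice[OF this, of 0] show ?thesis by simp
      qed
      ultimately show ?thesis by blast
    qed
  qed
  from this[of "{}" "{}", OF _ _ _ _ ignores_coordinates_empty] show ?thesis
    unfolding lifts_torus_loops_def by blast
qed

section \<open>The exponential law for compact Hausdorff exponents\<close>

lemma continuous_map_in_topspace: "continuous_map X Y f \<Longrightarrow> x \<in> topspace X \<Longrightarrow> f x \<in> topspace Y"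
  by (auto simp: continuous_map_def)

lemma continuous_mapI:
  assumes "\<And>x. x \<in> topspace X \<Longrightarrow> f x \<in> topspace Y"
    and "\<And>U. openin Y U \<Longrightarrow> openin X {x \<in> topspace X. f x \<in> U}"
  shows "continuous_map X Y f"
  using assms by (simp add: continuous_map_def)

lemma topspace_mapping_space:
  "f \<in> topspace (mapping_space X Y) \<longleftrightarrow> f \<in> extensional (topspace X) \<and> continuous_map X Y f"
proof
  assume "f \<in> extensional (topspace X) \<and> continuous_map X Y f"
  moreover have "compactin X {}" "openin Y {}" by auto
  ultimately show "f \<in> topspace (mapping_space X Y)"
    unfolding mapping_space_def topology_generated_by_topspace by blast
qed (auto simp: mapping_space_def)

lemma openin_mapping_space_subbasic:
  assumes "compactin X K" "openin Y U"
  shows "openin (mapping_space X Y) {f \<in> extensional (topspace X). continuous_map X Y f \<and> f ` K \<subseteq> U}"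
  unfolding mapping_space_def using assms by (intro topology_generated_by_Basis) blast

text \<open>Every neighbourhood of a point of \<open>X\<close> contains a compact one, and a condition on the values on this
compact set is an open condition on the map.\<close>

lemma continuous_map_uncurry:
  assumes X: "compact_space X" "Hausdorff_space X" and g: "continuous_map A (mapping_space X Y) g"
  shows "continuous_map (prod_topology A X) Y (\<lambda>(a, x). g a x)"
proof -
  have gc: "continuous_map X Y (g a)" if "a \<in> topspace A" for a
    using continuous_map_in_topspace[OF g that] by (simp add: topspace_mapping_space)
  have nb: "neighbourhood_base_of (compactin X) X"
    using locally_compact_space_neighbourhood_base compact_imp_locally_compact_space X by blast
  have "openin (prod_topology A X) {z \<in> topspace (prod_topology A X). (\<lambda>(a, x). g a x) z \<in> U}"
    if U: "openin Y U" for U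
    unfolding openin_prod_topology_alt
  proof (intro allI impI)
    fix a x assume "(a, x) \<in> {z \<in> topspace (prod_topology A X). (\<lambda>(a, x). g a x) z \<in> U}"
    then have a: "a \<in> topspace A" and x: "x \<in> topspace X" "g a x \<in> U" by auto
    have W: "openin X {x \<in> topspace X. g a x \<in> U}"
      using openin_continuous_map_preimage[OF gc[OF a] U] .
    have xW: "x \<in> {x \<in> topspace X. g a x \<in> U}" using x by simp
    obtain V K where V: "openin X V" "compactin X K" "x \<in> V" "V \<subseteq> K" "K \<subseteq> {x \<in> topspace X. g a x \<in> U}"
      using nb[unfolded neighbourhood_base_of, rule_format, OF conjI[OF W xW]] by (elim exE conjE) (rule that)
    let ?B = "{f \<in> extensional (topspace X). continuous_map X Y f \<and> f ` K \<subseteq> U}"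
    have "openin A {a \<in> topspace A. g a \<in> ?B}"
      by (rule openin_continuous_map_preimage[OF g openin_mapping_space_subbasic[OF V(2) U]])
    moreover have "g a \<in> topspace (mapping_space X Y)"
      by (rule continuous_map_in_topspace[OF g a])
    then have "a \<in> {a \<in> topspace A. g a \<in> ?B}"
      using a V(5) topspace_mapping_space[of "g a" X Y] by auto
    moreover have "{a \<in> topspace A. g a \<in> ?B} \<times> V \<subseteq> {z \<in> topspace (prod_topology A X). (\<lambda>(a, x). g a x) z \<in> U}"
      using V(4,5) by auto
    ultimately show "\<exists>N V. openin A N \<and> openin X V \<and> a \<in> N \<and> x \<in> V \<and>
        N \<times> V \<subseteq> {z \<in> topspace (prod_topology A X). (\<lambda>(a, x). g a x) z \<in> U}"
      using V(1,3) by blast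
  qed
  moreover have "(\<lambda>(a, x). g a x) z \<in> topspace Y" if "z \<in> topspace (prod_topology A X)" for z
    using that continuous_map_in_topspace[OF gc] by (cases z) simp
  ultimately show ?thesis by (intro continuous_mapI)
qed

text \<open>The tube lemma: if \<open>h a\<close> maps the compact set \<open>K\<close> into \<open>U\<close>, then so does \<open>h b\<close> for all \<open>b\<close> near \<open>a\<close>.\<close>

lemma continuous_map_curry:
  assumes h: "continuous_map (prod_topology A X) Y (\<lambda>(a, x). h a x)"
  shows "continuous_map A (mapping_space X Y) (\<lambda>a. \<lambda>x\<in>topspace X. h a x)"
proof -
  have hc: "continuous_map X Y (restrict (h a) (topspace X))" if "a \<in> topspace A" for a
    using continuous_map_slice[OF h that] by (rule continuous_map_eq) simp
  have top: "(\<lambda>x\<in>topspace X. h a x) \<in> topspace (mapping_space X Y)" if "a \<in> topspace A" for a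
    using hc[OF that] by (simp add: topspace_mapping_space)
  show ?thesis
    unfolding mapping_space_def
  proof (rule continuous_on_generated_topo)
    show "(\<lambda>a. \<lambda>x\<in>topspace X. h a x) ` topspace A \<subseteq> \<Union> {{f \<in> extensional (topspace X). continuous_map X Y f \<and> f ` K \<subseteq> U} | K U.
        compactin X K \<and> openin Y U}"
      using top unfolding mapping_space_def topology_generated_by_topspace by blast
    fix B assume "B \<in> {{f \<in> extensional (topspace X). continuous_map X Y f \<and> f ` K \<subseteq> U} | K U.
        compactin X K \<and> openin Y U}"
    then obtain K U where B: "B = {f \<in> extensional (topspace X). continuous_map X Y f \<and> f ` K \<subseteq> U}"
      and K: "compactin X K" and U: "openin Y U" by blast
    have KX: "K \<subseteq> topspace X" using compactin_subset_topspace[OF K] .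
    have eq: "(\<lambda>a. \<lambda>x\<in>topspace X. h a x) -` B \<inter> topspace A = {a \<in> topspace A. \<forall>x\<in>K. h a x \<in> U}"
      using hc KX by (auto simp: B subset_eq)
    let ?W = "{z \<in> topspace (prod_topology A X). (\<lambda>(a, x). h a x) z \<in> U}"
    have W: "openin (prod_topology A X) ?W"
      by (rule openin_continuous_map_preimage[OF h U])
    show "openin A ((\<lambda>a. \<lambda>x\<in>topspace X. h a x) -` B \<inter> topspace A)"
      unfolding eq
    proof (subst openin_subopen, intro ballI)
      fix a assume a: "a \<in> {a \<in> topspace A. \<forall>x\<in>K. h a x \<in> U}"
      then have "{a} \<times> K \<subseteq> ?W" using KX by auto
      from tube_lemma_right[OF W K _ this] a obtain N V
        where NV: "openin A N" "a \<in> N" "K \<subseteq> V" "N \<times> V \<subseteq> ?W" by auto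
      have "h b x \<in> U" if "b \<in> N" "x \<in> K" for b x
      proof -
        have "(b, x) \<in> ?W" using NV(3,4) that by blast
        then show ?thesis by simp
      qed
      then have "N \<subseteq> {a \<in> topspace A. \<forall>x\<in>K. h a x \<in> U}"
        using openin_subset[OF NV(1)] by blast
      then show "\<exists>T. openin A T \<and> a \<in> T \<and> T \<subseteq> {a \<in> topspace A. \<forall>x\<in>K. h a x \<in> U}"
        using NV by blast
    qed
  qed
qed

lemma continuous_map_postcompose:
  assumes X: "compact_space X" "Hausdorff_space X" and p: "continuous_map Z Y p"
  shows "continuous_map (mapping_space X Z) (mapping_space X Y) (\<lambda>u. \<lambda>x\<in>topspace X. p (u x))"
proof (rule continuous_map_curry)
  have "continuous_map (prod_topology (mapping_space X Z) X) Y (p \<circ> (\<lambda>(u, x). u x))"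
    using continuous_map_compose[OF continuous_map_uncurry[OF X continuous_map_id] p] by simp
  then show "continuous_map (prod_topology (mapping_space X Z) X) Y (\<lambda>(u, x). p (u x))"
    by (simp add: o_def case_prod_unfold)
qed

lemma continuous_map_evaluation:
  assumes "x \<in> topspace X"
  shows "continuous_map (mapping_space X Y) Y (\<lambda>u. u x)"
proof -
  have "u x \<in> topspace Y" if "u \<in> topspace (mapping_space X Y)" for u
    using that assms by (auto simp: topspace_mapping_space continuous_map_def)
  moreover have "openin (mapping_space X Y) {u \<in> topspace (mapping_space X Y). u x \<in> U}" if "openin Y U" for U
  proof -
    have "compactin X {x}" using assms by simp
    from openin_mapping_space_subbasic[OF this that] show ?thesis
      by (simp add: topspace_mapping_space conj_assoc)
  qed
  ultimately show ?thesis by (intro continuous_mapI)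
qed

section \<open>Loops of maps from a torus as maps on the cube\<close>

lemma compact_space_cube: "compact_space (cube n)"
  by (simp add: cube_def compact_space_product_topology compact_space_subtopology)

lemma compact_space_torus: "compact_space (torus k)"
  by (simp add: torus_def compact_space_product_topology compact_space_subtopology)

lemma Hausdorff_space_cube: "Hausdorff_space (cube n)"
  by (simp add: cube_def Hausdorff_space_product_topology Hausdorff_space_subtopology)

lemma Hausdorff_space_torus: "Hausdorff_space (torus k)"
  by (simp add: torus_def Hausdorff_space_product_topology Hausdorff_space_subtopology)

text \<open>The torus coordinate \<open>i\<close> corresponds to the cube coordinate \<open>Suc i\<close>, as coordinate \<open>0\<close> is the time
of the loop.\<close>

definition wrap :: "nat \<Rightarrow> (nat \<Rightarrow> real) \<Rightarrow> nat \<Rightarrow> complex" where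
  "wrap n x = (\<lambda>i\<in>{..<n - 1}. cis (2 * pi * x (Suc i)))"

text \<open>A right inverse of the quotient map from the cube to interval times torus. It jumps where a torus
coordinate passes \<open>1\<close>; a torus loop takes equal values on the two sides of the jump.\<close>

definition unwrap :: "nat \<Rightarrow> (nat \<Rightarrow> real) \<Rightarrow> (nat \<Rightarrow> complex) \<Rightarrow> nat \<Rightarrow> real" where
  "unwrap n q v = (\<lambda>i\<in>{..<n}. if i = 0 then q 0 else Arg2pi (v (i - 1)) / (2 * pi))"

definition unroll :: "nat \<Rightarrow> ((nat \<Rightarrow> real) \<Rightarrow> (nat \<Rightarrow> complex) \<Rightarrow> 'a) \<Rightarrow> (nat \<Rightarrow> real) \<Rightarrow> 'a" where
  "unroll n f x = f (restrict x {..<1}) (wrap n x)"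

definition roll :: "nat \<Rightarrow> ((nat \<Rightarrow> real) \<Rightarrow> 'a) \<Rightarrow> (nat \<Rightarrow> real) \<Rightarrow> (nat \<Rightarrow> complex) \<Rightarrow> 'a" where
  "roll n g q = (\<lambda>v\<in>topspace (torus (n - 1)). g (unwrap n q v))"

lemma continuous_map_wrap: "continuous_map (cube n) (torus (n - 1)) (wrap n)"
proof -
  have "continuous_map (cube n) (top_of_set (sphere 0 1)) (\<lambda>x. wrap n x i)" if i: "i < n - 1" for i
  proof -
    have "continuous_map (cube n) euclideanreal (\<lambda>x. x (Suc i))"
      by (rule continuous_map_cube_component[OF continuous_map_id[unfolded id_def]]) (use i in simp)
    moreover have "continuous_map euclideanreal euclidean (\<lambda>t. cis (2 * pi * t))"
      by (simp, intro continuous_intros)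
    ultimately have "continuous_map (cube n) euclidean (\<lambda>x. cis (2 * pi * x (Suc i)))"
      using continuous_map_compose[of "cube n" euclideanreal "\<lambda>x. x (Suc i)" euclidean "\<lambda>t. cis (2 * pi * t)"]
      by (simp add: o_def)
    then show ?thesis using i by (auto simp: wrap_def continuous_map_in_subtopology)
  qed
  then show ?thesis unfolding torus_def continuous_map_componentwise by (auto simp: wrap_def)
qed

lemma continuous_map_first_coordinate: "1 \<le> n \<Longrightarrow> continuous_map (cube n) (cube 1) (\<lambda>x. restrict x {..<1})"
proof -
  assume n: "1 \<le> n"
  have "continuous_map (cube n) (top_of_set {0..1}) (\<lambda>x. restrict x {..<1} i)" if "i < 1" for i
    using that n unfolding cube_def
    by (auto intro: continuous_map_product_projection)
  then show ?thesis unfolding cube_def[of 1] continuous_map_componentwise by auto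
qed

lemma unwrap_in_cube:
  assumes n: "1 \<le> n" and q: "q \<in> topspace (cube 1)"
  shows "unwrap n q v \<in> topspace (cube n)"
proof -
  have "0 \<le> Arg2pi u / (2 * pi)" "Arg2pi u / (2 * pi) \<le> 1" for u
    using Arg2pi_ge_0[of u] Arg2pi_lt_2pi[of u] by (auto simp: field_simps)
  then show ?thesis using q by (auto simp: topspace_cube unwrap_def)
qed

lemma wrap_unwrap:
  assumes n: "1 \<le> n" and q: "q \<in> topspace (cube 1)" and v: "v \<in> topspace (torus (n - 1))"
  shows "restrict (unwrap n q v) {..<1} = q" "wrap n (unwrap n q v) = v"
proof -
  show "restrict (unwrap n q v) {..<1} = q"
    by (rule extensionalityI[of _ "{..<1}"]) (use n q in \<open>auto simp: topspace_cube unwrap_def\<close>)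
  have "cis (Arg2pi (v i)) = v i" if "i < n - 1" for i
  proof -
    have "norm (v i) = 1" using v that by (auto simp: torus_def PiE_iff)
    then show ?thesis using complex_norm_eq_1_exp by (simp add: cis_conv_exp)
  qed
  then show "wrap n (unwrap n q v) = v"
    by (intro extensionalityI[of _ "{..<n - 1}"]) (use v in \<open>auto simp: torus_def PiE_iff wrap_def unwrap_def\<close>)
qed

text \<open>Periodicity changes one coordinate at a time from \<open>1\<close> to \<open>0\<close>; the bound \<open>m\<close> carries the induction
that changes all of them.\<close>

lemma torus_loop_wrap_to_zero:
  assumes g: "torus_loop n y S g" and x: "x \<in> topspace (cube n)" and "m \<le> n"
  shows "g (\<lambda>i. if 1 \<le> i \<and> i < m \<and> x i = 1 then 0 else x i) = g x"
  using \<open>m \<le> n\<close>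
proof (induction m)
  case (Suc m)
  let ?w = "\<lambda>m i. if 1 \<le> i \<and> i < m \<and> x i = 1 then 0 else x i"
  have w: "?w m \<in> topspace (cube n)"
    using x Suc.prems by (auto simp: topspace_cube extensional_def)
  have "g (?w (Suc m)) = g (?w m)"
  proof (cases "1 \<le> m \<and> x m = 1")
    case True
    then have "?w (Suc m) = (?w m)(m := 0)" "?w m = (?w m)(m := 1)"
      by (auto simp: fun_eq_iff less_Suc_eq)
    then show ?thesis using torus_loop_periodic[OF g w, of m] True Suc.prems by simp
  next
    case False
    then have "?w (Suc m) = ?w m" by (auto simp: fun_eq_iff less_Suc_eq)
    then show ?thesis by simp
  qed
  then show ?case using Suc by simp
qed simp

lemma torus_loop_unwrap_wrap:
  assumes n: "1 \<le> n" and g: "torus_loop n y S g" and x: "x \<in> topspace (cube n)"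
  shows "g (unwrap n (restrict x {..<1}) (wrap n x)) = g x"
proof -
  have "unwrap n (restrict x {..<1}) (wrap n x) = (\<lambda>i. if 1 \<le> i \<and> i < n \<and> x i = 1 then 0 else x i)"
  proof
    fix i
    consider "n \<le> i" | "i = 0" "i < n" | k where "i = Suc k" "i < n" using not_le_imp_less not0_implies_Suc by blast
    then show "unwrap n (restrict x {..<1}) (wrap n x) i = (if 1 \<le> i \<and> i < n \<and> x i = 1 then 0 else x i)"
    proof cases
      case 1
      then show ?thesis using x by (auto simp: unwrap_def topspace_cube extensional_def)
    next
      case 2
      then show ?thesis by (simp add: unwrap_def)
    next
      case 3
      have b: "0 \<le> x i" "x i \<le> 1" using x 3 by (auto simp: topspace_cube)
      have one: "Arg2pi 1 = 0" using Arg2pi_unique[of 1 0 1] by simp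
      have "Arg2pi (cis (2 * pi * x i)) = (if x i = 1 then 0 else 2 * pi * x i)"
      proof (cases "x i = 1")
        case True
        then show ?thesis using one by simp
      next
        case False
        then have "Arg2pi (cis (2 * pi * x i)) = 2 * pi * x i"
          using b by (intro Arg2pi_unique[of 1]) (auto simp: cis_conv_exp)
        then show ?thesis using False by simp
      qed
      moreover have "k < n - 1" using 3 by simp
      ultimately show ?thesis using 3 one by (simp add: unwrap_def wrap_def)
    qed
  qed
  then show ?thesis using torus_loop_wrap_to_zero[OF g x order_refl] by simp
qed

text \<open>Products of quotient maps need not be quotient maps, but a continuous map from a compact space to a
Hausdorff space is proper, and properness is inherited by the product with an identity. A proper
surjection is closed and therefore a quotient map.\<close>

lemma quotient_map_wrap:
  assumes n: "1 \<le> n"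
  shows "quotient_map (prod_topology W (cube n)) (prod_topology W (prod_topology (cube 1) (torus (n - 1))))
           (\<lambda>(w, x). (w, (restrict x {..<1}, wrap n x)))"
proof (rule continuous_closed_imp_quotient_map)
  let ?e = "\<lambda>x. (restrict x {..<1}, wrap n x)"
  have e: "continuous_map (cube n) (prod_topology (cube 1) (torus (n - 1))) ?e"
    using n by (intro continuous_map_pairedI continuous_map_first_coordinate continuous_map_wrap)
  have "kc_space (prod_topology (cube 1) (torus (n - 1)))"
    by (intro Hausdorff_imp_kc_space) (simp add: Hausdorff_space_prod_topology Hausdorff_space_cube Hausdorff_space_torus)
  then have "proper_map (cube n) (prod_topology (cube 1) (torus (n - 1))) ?e"
    using continuous_imp_proper_map compact_space_cube e by blast
  then have "proper_map (prod_topology W (cube n)) (prod_topology W (prod_topology (cube 1) (torus (n - 1))))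
      (\<lambda>(w, x). (id w, ?e x))"
    unfolding proper_map_prod using proper_map_id by blast
  then show "closed_map (prod_topology W (cube n)) (prod_topology W (prod_topology (cube 1) (torus (n - 1))))
      (\<lambda>(w, x). (w, ?e x))"
    using proper_imp_closed_map by fastforce
  have "continuous_map (prod_topology W (cube n)) (prod_topology W (prod_topology (cube 1) (torus (n - 1))))
      (\<lambda>a. (fst a, (?e \<circ> snd) a))"
    by (intro continuous_map_pairedI continuous_map_fst continuous_map_compose[OF continuous_map_snd e])
  then show cont: "continuous_map (prod_topology W (cube n)) (prod_topology W (prod_topology (cube 1) (torus (n - 1))))
      (\<lambda>(w, x). (w, ?e x))"
    by (simp add: o_def case_prod_unfold)
  show "(\<lambda>(w, x). (w, ?e x)) ` topspace (prod_topology W (cube n)) =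
      topspace (prod_topology W (prod_topology (cube 1) (torus (n - 1))))"
  proof (intro equalityI subsetI)
    fix a assume "a \<in> topspace (prod_topology W (prod_topology (cube 1) (torus (n - 1))))"
    then obtain w q v where a: "a = (w, (q, v))" "w \<in> topspace W" "q \<in> topspace (cube 1)" "v \<in> topspace (torus (n - 1))"
      by auto
    then have "a = (\<lambda>(w, x). (w, ?e x)) (w, unwrap n q v)" "(w, unwrap n q v) \<in> topspace (prod_topology W (cube n))"
      using wrap_unwrap[OF n a(3,4)] unwrap_in_cube[OF n a(3)] by auto
    then show "a \<in> (\<lambda>(w, x). (w, ?e x)) ` topspace (prod_topology W (cube n))" by blast
  qed (use continuous_map_image_subset_topspace[OF cont] in blast)
qed

lemma continuous_map_unroll:
  assumes n: "1 \<le> n" and h: "continuous_map (prod_topology W (cube 1)) (mapping_space (torus (n - 1)) Y) h"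
  shows "continuous_map (prod_topology W (cube n)) Y (\<lambda>(w, x). unroll n (\<lambda>q. h (w, q)) x)"
proof -
  have "continuous_map (prod_topology W (cube n)) (prod_topology (prod_topology W (cube 1)) (torus (n - 1)))
      (\<lambda>a. ((fst a, ((\<lambda>x. restrict x {..<1}) \<circ> snd) a), (wrap n \<circ> snd) a))"
    by (intro continuous_map_pairedI continuous_map_fst continuous_map_compose[OF continuous_map_snd]
        continuous_map_first_coordinate[OF n] continuous_map_wrap)
  from continuous_map_compose[OF this continuous_map_uncurry[OF compact_space_torus Hausdorff_space_torus h]]
  show ?thesis by (simp add: o_def case_prod_unfold unroll_def)
qed

lemma torus_loop_unroll:
  assumes n: "1 \<le> n" and f: "\<forall>q\<in>cube_boundary 1. f q = (\<lambda>t\<in>topspace (torus (n - 1)). y)"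
  shows "torus_loop n y {} (unroll n f)"
proof (rule torus_loopI)
  fix x assume x: "x \<in> topspace (cube n)"
  have w: "wrap n x \<in> topspace (torus (n - 1))" by (rule continuous_map_in_topspace[OF continuous_map_wrap x])
  have r: "restrict x {..<1} \<in> topspace (cube 1)"
    by (rule continuous_map_in_topspace[OF continuous_map_first_coordinate[OF n] x])
  show "unroll n f x = y" if "x 0 = 0 \<or> x 0 = 1"
  proof -
    have "restrict x {..<1} \<in> cube_boundary 1" using that r by (auto simp: cube_boundary_def)
    then show ?thesis using f w by (simp add: unroll_def)
  qed
  show "unroll n f (x(j := 0)) = unroll n f (x(j := 1))" if j: "1 \<le> j" "j < n" for j
  proof -
    have "wrap n (x(j := 0)) = wrap n (x(j := 1))" by (auto simp: wrap_def fun_eq_iff restrict_def)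
    moreover have "restrict (x(j := 0)) {..<1} = restrict (x(j := 1)) {..<1}" using j by (auto simp: fun_eq_iff restrict_def)
    ultimately show ?thesis by (simp add: unroll_def)
  qed
qed simp

text \<open>The map \<open>(w, q, v) \<mapsto> h (w, unwrap n q v)\<close> is continuous, although \<open>unwrap\<close> is not, since its
composition with the quotient map is \<open>h\<close> by periodicity.\<close>

lemma continuous_map_roll:
  assumes n: "1 \<le> n" and h: "continuous_map (prod_topology W (cube n)) Y h"
    and loop: "\<And>w. w \<in> topspace W \<Longrightarrow> torus_loop n y S (\<lambda>x. h (w, x))"
  shows "continuous_map (prod_topology W (cube 1)) (mapping_space (torus (n - 1)) Y) (\<lambda>(w, q). roll n (\<lambda>x. h (w, x)) q)"
proof -
  let ?k = "\<lambda>(w, (q, v)). h (w, unwrap n q v)"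
  have "continuous_map (prod_topology W (cube n)) Y (?k \<circ> (\<lambda>(w, x). (w, (restrict x {..<1}, wrap n x))))"
    using torus_loop_unwrap_wrap[OF n loop] by (intro continuous_map_eq[OF h]) auto
  then have k: "continuous_map (prod_topology W (prod_topology (cube 1) (torus (n - 1)))) Y ?k"
    by (rule continuous_compose_quotient_map[OF quotient_map_wrap[OF n]])
  have "continuous_map (prod_topology (prod_topology W (cube 1)) (torus (n - 1)))
      (prod_topology W (prod_topology (cube 1) (torus (n - 1)))) (\<lambda>a. ((fst \<circ> fst) a, ((snd \<circ> fst) a, snd a)))"
    by (intro continuous_map_pairedI continuous_map_compose[OF continuous_map_fst] continuous_map_fst continuous_map_snd)
  from continuous_map_compose[OF this k]
  have "continuous_map (prod_topology (prod_topology W (cube 1)) (torus (n - 1))) Y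
      (\<lambda>(a, v). (\<lambda>(w, q). \<lambda>v. h (w, unwrap n q v)) a v)"
    by (simp add: o_def case_prod_unfold)
  from continuous_map_curry[OF this] show ?thesis by (simp add: roll_def case_prod_unfold)
qed

lemma roll_boundary:
  assumes n: "1 \<le> n" and g: "torus_loop n y S g" and q: "q \<in> cube_boundary 1"
  shows "roll n g q = (\<lambda>t\<in>topspace (torus (n - 1)). y)"
proof -
  have q1: "q \<in> topspace (cube 1)" "q 0 = 0 \<or> q 0 = 1" using q by (auto simp: cube_boundary_def)
  have "g (unwrap n q v) = y" for v
    using q1 n by (intro torus_loop_end[OF g unwrap_in_cube[OF n q1(1)]]) (auto simp: unwrap_def)
  then show ?thesis by (simp add: roll_def)
qed

lemma unroll_roll:
  assumes n: "1 \<le> n" and g: "torus_loop n y S g" and x: "x \<in> topspace (cube n)"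
  shows "unroll n (roll n g) x = g x"
proof -
  have "wrap n x \<in> topspace (torus (n - 1))" by (rule continuous_map_in_topspace[OF continuous_map_wrap x])
  then show ?thesis using torus_loop_unwrap_wrap[OF n g x] by (simp add: unroll_def roll_def)
qed

lemma roll_unroll:
  assumes n: "1 \<le> n" and q: "q \<in> topspace (cube 1)" and f: "f q \<in> extensional (topspace (torus (n - 1)))"
  shows "roll n (unroll n f) q = f q"
proof (rule extensionalityI[OF _ f])
  show "roll n (unroll n f) q v = f q v" if "v \<in> topspace (torus (n - 1))" for v
    using wrap_unwrap[OF n q that] that by (simp add: roll_def unroll_def)
qed (simp add: roll_def)

lemma unroll_spheroid:
  assumes n: "1 \<le> n" and f: "f \<in> spheroids 1 (mapping_space (torus (n - 1)) Y) (\<lambda>t\<in>topspace (torus (n - 1)). y)"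
  shows "continuous_map (cube n) Y (unroll n f)" "torus_loop n y {} (unroll n f)"
proof -
  have f': "continuous_map (cube 1) (mapping_space (torus (n - 1)) Y) f" using f by (simp add: spheroids_def)
  have "continuous_map (prod_topology (discrete_topology UNIV) (cube n)) Y
      (\<lambda>(w::nat, x). unroll n (\<lambda>q. (\<lambda>(w, q). f q) (w, q)) x)"
    by (rule continuous_map_unroll[OF n continuous_map_constant_family[OF f']])
  from continuous_map_slice[OF this, of 0] show "continuous_map (cube n) Y (unroll n f)" by simp
  show "torus_loop n y {} (unroll n f)" using f by (intro torus_loop_unroll[OF n]) (simp add: spheroids_def)
qed

lemma roll_spheroid:
  assumes n: "1 \<le> n" and g: "continuous_map (cube n) Y g" "torus_loop n y S g"
  shows "roll n g \<in> spheroids 1 (mapping_space (torus (n - 1)) Y) (\<lambda>t\<in>topspace (torus (n - 1)). y)"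
proof -
  have "continuous_map (prod_topology (discrete_topology UNIV) (cube 1)) (mapping_space (torus (n - 1)) Y)
      (\<lambda>(w::nat, q). roll n (\<lambda>x. (\<lambda>(w, x). g x) (w, x)) q)"
    by (rule continuous_map_roll[OF n continuous_map_constant_family[OF g(1)]]) (use g(2) in simp)
  from continuous_map_slice[OF this, of 0]
  show ?thesis using roll_boundary[OF n g(2)] by (simp add: spheroids_def)
qed

lemma unroll_homotopic:
  assumes n: "1 \<le> n"
    and fg: "(f, g) \<in> spheroid_homotopy 1 (mapping_space (torus (n - 1)) Y) (\<lambda>t\<in>topspace (torus (n - 1)). y)"
  shows "torus_homotopic n Y y {} (unroll n f) (unroll n g)"
proof -
  obtain h where h: "continuous_map (prod_topology (top_of_set {0..1::real}) (cube 1)) (mapping_space (torus (n - 1)) Y) h"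
      "\<forall>q. h (0, q) = f q" "\<forall>q. h (1, q) = g q"
      "\<forall>t\<in>{0..1}. \<forall>q\<in>cube_boundary 1. h (t, q) = (\<lambda>t\<in>topspace (torus (n - 1)). y)"
    using fg unfolding spheroid_homotopy_def homotopic_with_def by blast
  show ?thesis
  proof (rule torus_homotopicI[OF continuous_map_unroll[OF n h(1)]])
    show "torus_loop n y {} (\<lambda>x. (\<lambda>(w, x). unroll n (\<lambda>q. h (w, q)) x) (t, x))" if "0 \<le> t" "t \<le> 1" for t
      unfolding split using h(4) that by (intro torus_loop_unroll[OF n]) simp
  qed (simp_all add: h)
qed

lemma roll_homotopic:
  assumes n: "1 \<le> n" and fg: "torus_homotopic n Y y S f g"
  shows "(roll n f, roll n g) \<in> spheroid_homotopy 1 (mapping_space (torus (n - 1)) Y) (\<lambda>t\<in>topspace (torus (n - 1)). y)"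
proof -
  obtain h where h: "continuous_map (prod_topology (top_of_set {0..1::real}) (cube n)) Y h"
    "\<And>x. h (0, x) = f x" "\<And>x. h (1, x) = g x" "\<And>t. t \<in> {0..1} \<Longrightarrow> torus_loop n y S (\<lambda>x. h (t, x))"
    by (rule torus_homotopicE[OF fg]) (rule that)
  have "continuous_map (prod_topology (top_of_set {0..1}) (cube 1)) (mapping_space (torus (n - 1)) Y)
      (\<lambda>(t, q). roll n (\<lambda>x. h (t, x)) q)"
    by (rule continuous_map_roll[OF n h(1)]) (use h(4) in simp)
  then show ?thesis
    unfolding spheroid_homotopy_def homotopic_with_def
    by (intro CollectI case_prodI exI conjI ballI)
      (assumption, use h(2,3) roll_boundary[OF n h(4)] in simp_all)
qed

section \<open>Surjectivity on homotopy groups and on Fox groups\<close>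

lemma spheroid_homotopy_equiv: "equiv (spheroids n Y y) (spheroid_homotopy n Y y)"
proof (rule equivI)
  show "spheroid_homotopy n Y y \<subseteq> spheroids n Y y \<times> spheroids n Y y"
    by (auto simp: spheroid_homotopy_def spheroids_def
        dest: homotopic_with_imp_continuous_maps homotopic_with_imp_property)
  show "refl_on (spheroids n Y y) (spheroid_homotopy n Y y)"
    by (auto simp: refl_on_def spheroid_homotopy_def spheroids_def)
  show "sym (spheroid_homotopy n Y y)"
    by (auto simp: sym_def spheroid_homotopy_def homotopic_with_sym)
  show "trans (spheroid_homotopy n Y y)"
    unfolding trans_def spheroid_homotopy_def using homotopic_with_trans by fastforce
qed

lemma homotopy_group_map_class:
  assumes p: "continuous_map Z Y p" "p z = y" and F: "F \<in> spheroids n Z z"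
  shows "homotopy_group_map n Y y p (spheroid_homotopy n Z z `` {F}) = spheroid_homotopy n Y y `` {p \<circ> F}"
proof -
  have hom: "(p \<circ> F, p \<circ> G) \<in> spheroid_homotopy n Y y" if "(F, G) \<in> spheroid_homotopy n Z z" for G
    using that p unfolding spheroid_homotopy_def
    by (auto intro: homotopic_with_compose_continuous_map_left)
  have FF: "(F, F) \<in> spheroid_homotopy n Z z"
    using F spheroid_homotopy_equiv by (metis equiv_class_self Image_singleton_iff)
  show ?thesis
    unfolding homotopy_group_map_def
    using hom FF spheroid_homotopy_equiv[of n Y y] unfolding equiv_def
    by (auto simp: Image_iff; metis symD transD)
qed

lemma homotopy_group_map_surjective_iff:
  assumes p: "continuous_map Z Y p" "p z = y"
  shows "homotopy_group_map n Y y p ` carrier (homotopy_group n Z z) = carrier (homotopy_group n Y y) \<longleftrightarrow>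
    (\<forall>f\<in>spheroids n Y y. \<exists>F\<in>spheroids n Z z. (p \<circ> F, f) \<in> spheroid_homotopy n Y y)"
    (is "?lhs \<longleftrightarrow> ?rhs")
proof -
  let ?R = "spheroid_homotopy n Y y"
  have comp: "p \<circ> F \<in> spheroids n Y y" if "F \<in> spheroids n Z z" for F
    using that p by (auto simp: spheroids_def intro: continuous_map_compose)
  have carrier: "carrier (homotopy_group n W w) = (\<lambda>f. spheroid_homotopy n W w `` {f}) ` spheroids n W w"
    for W :: "'c topology" and w
    by (auto simp: homotopy_group_def quotient_def)
  have image: "homotopy_group_map n Y y p ` carrier (homotopy_group n Z z) = (\<lambda>F. ?R `` {p \<circ> F}) ` spheroids n Z z"
    unfolding carrier image_image by (rule image_cong[OF refl]) (rule homotopy_group_map_class[OF p])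
  have same: "?R `` {p \<circ> F} = ?R `` {f} \<longleftrightarrow> (p \<circ> F, f) \<in> ?R" if "F \<in> spheroids n Z z" "f \<in> spheroids n Y y" for F f
    using eq_equiv_class_iff[OF spheroid_homotopy_equiv comp[OF that(1)] that(2)] .
  have "?lhs \<longleftrightarrow> (\<forall>f\<in>spheroids n Y y. \<exists>F\<in>spheroids n Z z. ?R `` {p \<circ> F} = ?R `` {f})"
    unfolding image unfolding carrier
  proof
    assume "(\<lambda>F. ?R `` {p \<circ> F}) ` spheroids n Z z = (\<lambda>f. ?R `` {f}) ` spheroids n Y y"
    then show "\<forall>f\<in>spheroids n Y y. \<exists>F\<in>spheroids n Z z. ?R `` {p \<circ> F} = ?R `` {f}"
      by (metis (no_types, lifting) imageE image_eqI)
  next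
    assume onto: "\<forall>f\<in>spheroids n Y y. \<exists>F\<in>spheroids n Z z. ?R `` {p \<circ> F} = ?R `` {f}"
    show "(\<lambda>F. ?R `` {p \<circ> F}) ` spheroids n Z z = (\<lambda>f. ?R `` {f}) ` spheroids n Y y"
    proof (intro equalityI image_subsetI)
      fix F assume "F \<in> spheroids n Z z"
      then show "?R `` {p \<circ> F} \<in> (\<lambda>f. ?R `` {f}) ` spheroids n Y y" using comp by (intro imageI)
    next
      fix f assume "f \<in> spheroids n Y y"
      with onto obtain F where "F \<in> spheroids n Z z" "?R `` {p \<circ> F} = ?R `` {f}" by (elim ballE bexE) auto
      then show "?R `` {f} \<in> (\<lambda>F. ?R `` {p \<circ> F}) ` spheroids n Z z" by (intro image_eqI) auto
    qed
  qed
  also have "\<dots> \<longleftrightarrow> ?rhs"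
    by (intro ball_cong bex_cong refl same)
  finally show ?thesis .
qed

lemma lifts_spheroids_iff:
  assumes "1 \<le> n"
  shows "(\<forall>f\<in>spheroids n Y y. \<exists>F\<in>spheroids n Z z. (p \<circ> F, f) \<in> spheroid_homotopy n Y y) \<longleftrightarrow>
     lifts_torus_loops n {1..<n} Z z Y y p"
  unfolding lifts_torus_loops_def
  by (simp add: Ball_def Bex_def spheroids_eq_torus_loops[OF assms] spheroid_homotopy_eq_torus_homotopic[OF assms] conj_assoc)

text \<open>\<open>roll\<close> and \<open>unroll\<close> are mutually inverse up to values outside the cube, they preserve homotopies,
and they carry composition with \<open>p\<close> to the induced map between the mapping spaces.\<close>

lemma fox_lifting_iff:
  fixes n :: nat and p :: "'b \<Rightarrow> 'a"
  defines "T \<equiv> topspace (torus (n - 1))"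
  assumes n: "1 \<le> n" and p: "continuous_map Z Y p" "p z = y"
  shows "(\<forall>f\<in>spheroids 1 (mapping_space (torus (n - 1)) Y) (\<lambda>t\<in>T. y).
      \<exists>F\<in>spheroids 1 (mapping_space (torus (n - 1)) Z) (\<lambda>t\<in>T. z).
        ((\<lambda>u. \<lambda>t\<in>T. p (u t)) \<circ> F, f) \<in> spheroid_homotopy 1 (mapping_space (torus (n - 1)) Y) (\<lambda>t\<in>T. y))
    \<longleftrightarrow> lifts_torus_loops n {} Z z Y y p"
    (is "?lhs \<longleftrightarrow> ?rhs")
proof
  assume lhs: ?lhs
  show ?rhs
    unfolding lifts_torus_loops_def
  proof (intro allI impI)
    fix f assume "continuous_map (cube n) Y f \<and> torus_loop n y {} f"
    then have f: "continuous_map (cube n) Y f" "torus_loop n y {} f" by auto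
    obtain F where F: "F \<in> spheroids 1 (mapping_space (torus (n - 1)) Z) (\<lambda>t\<in>T. z)"
      and hom: "((\<lambda>u. \<lambda>t\<in>T. p (u t)) \<circ> F, roll n f) \<in> spheroid_homotopy 1 (mapping_space (torus (n - 1)) Y) (\<lambda>t\<in>T. y)"
      using lhs roll_spheroid[OF n f] unfolding T_def by blast
    have "torus_homotopic n Y y {} (p \<circ> unroll n F) f"
    proof (rule torus_homotopic_eq[OF unroll_homotopic[OF n hom[unfolded T_def]]])
      fix x assume x: "x \<in> topspace (cube n)"
      have "wrap n x \<in> topspace (torus (n - 1))" by (rule continuous_map_in_topspace[OF continuous_map_wrap x])
      then show "unroll n ((\<lambda>u. \<lambda>t\<in>topspace (torus (n - 1)). p (u t)) \<circ> F) x = (p \<circ> unroll n F) x"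
        by (simp add: unroll_def)
      show "unroll n (roll n f) x = f x" by (rule unroll_roll[OF n f(2) x])
    qed
    then show "\<exists>F. continuous_map (cube n) Z F \<and> torus_loop n z {} F \<and> torus_homotopic n Y y {} (p \<circ> F) f"
      using unroll_spheroid[OF n F[unfolded T_def]] by blast
  qed
next
  assume rhs: ?rhs
  show ?lhs
  proof
    fix f assume f: "f \<in> spheroids 1 (mapping_space (torus (n - 1)) Y) (\<lambda>t\<in>T. y)"
    obtain F where F: "continuous_map (cube n) Z F" "torus_loop n z {} F" "torus_homotopic n Y y {} (p \<circ> F) (unroll n f)"
      using lifts_torus_loopsD[OF rhs unroll_spheroid[OF n f[unfolded T_def]]] by blast
    have roll: "roll n (p \<circ> F) = (\<lambda>u. \<lambda>t\<in>T. p (u t)) \<circ> roll n F"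
      by (auto simp: roll_def T_def fun_eq_iff restrict_def)
    have fc: "continuous_map (cube 1) (mapping_space (torus (n - 1)) Y) f" using f by (simp add: spheroids_def)
    have same: "roll n (unroll n f) q = f q" if "q \<in> topspace (cube 1)" for q
    proof -
      have "f q \<in> topspace (mapping_space (torus (n - 1)) Y)" by (rule continuous_map_in_topspace[OF fc that])
      then show ?thesis by (intro roll_unroll[OF n that]) (simp add: topspace_mapping_space)
    qed
    have "roll n (unroll n f) \<in> spheroids 1 (mapping_space (torus (n - 1)) Y) (\<lambda>t\<in>T. y)"
      unfolding T_def by (rule roll_spheroid[OF n unroll_spheroid[OF n f[unfolded T_def]]])
    then have "(roll n (unroll n f), f) \<in> spheroid_homotopy 1 (mapping_space (torus (n - 1)) Y) (\<lambda>t\<in>T. y)"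
      using f same unfolding spheroid_homotopy_def spheroids_def
      by (auto intro!: homotopic_with_equal)
    moreover have "(roll n (p \<circ> F), roll n (unroll n f)) \<in> spheroid_homotopy 1 (mapping_space (torus (n - 1)) Y) (\<lambda>t\<in>T. y)"
      unfolding T_def by (rule roll_homotopic[OF n F(3)])
    ultimately have "(roll n (p \<circ> F), f) \<in> spheroid_homotopy 1 (mapping_space (torus (n - 1)) Y) (\<lambda>t\<in>T. y)"
      using spheroid_homotopy_equiv unfolding equiv_def by (meson transD)
    then show "\<exists>F\<in>spheroids 1 (mapping_space (torus (n - 1)) Z) (\<lambda>t\<in>T. z).
        ((\<lambda>u. \<lambda>t\<in>T. p (u t)) \<circ> F, f) \<in> spheroid_homotopy 1 (mapping_space (torus (n - 1)) Y) (\<lambda>t\<in>T. y)"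
      using roll_spheroid[OF n F(1,2)] unfolding roll T_def by blast
  qed
qed

lemma surjective_on_homotopy_iff_surjective_on_fox:
  assumes p: "continuous_map Z Y p" "p z = y"
  shows "(\<forall>n\<ge>1. homotopy_group_map n Y y p ` carrier (homotopy_group n Z z) = carrier (homotopy_group n Y y)) \<longleftrightarrow>
     (\<forall>n\<ge>1. fox_group_map n Y y p ` carrier (fox_group n Z z) = carrier (fox_group n Y y))"
proof -
  have 1: "homotopy_group_map n Y y p ` carrier (homotopy_group n Z z) = carrier (homotopy_group n Y y)
      \<longleftrightarrow> lifts_torus_loops n {1..<n} Z z Y y p" if "1 \<le> n" for n
    using homotopy_group_map_surjective_iff[OF p] lifts_spheroids_iff[OF that] by metis
  have 2: "fox_group_map n Y y p ` carrier (fox_group n Z z) = carrier (fox_group n Y y)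
      \<longleftrightarrow> lifts_torus_loops n {} Z z Y y p" if n: "1 \<le> n" for n
    unfolding fox_group_map_def fox_group_def fox_lifting_iff[OF n p, symmetric]
    by (rule homotopy_group_map_surjective_iff)
      (use p continuous_map_postcompose[OF compact_space_torus Hausdorff_space_torus p(1)] in \<open>auto simp: restrict_def\<close>)
  show ?thesis
    using 1 2 lifts_torus_loops_imp_lifts_spheroids lifts_spheroids_imp_lifts_torus_loops[OF p] by metis
qed

text \<open>Evaluation at the base point is a continuous map from the self-maps of \<open>X\<close> that takes the identity
to \<open>x\<^sub>0\<close>, and both notions ask for its surjectivity, on homotopy groups and on Fox groups.\<close>

theorem proposition2p4:
  fixes X :: "'a topology" and x\<^sub>0 :: 'a
  assumes "k_space X" and "Hausdorff_space X" and "path_connected_space X"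
    and "x\<^sub>0 \<in> topspace X"
  shows "gottlieb_space X x\<^sub>0 \<longleftrightarrow> gottlieb_fox_space X x\<^sub>0"
  unfolding gottlieb_space_def gottlieb_fox_space_def gottlieb_group_def gottlieb_fox_group_def
  by (rule surjective_on_homotopy_iff_surjective_on_fox[OF continuous_map_evaluation]) (use assms(4) in auto)

end
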